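(* Let $T$ be a tree on $n$ vertices which is neither a path nor of the form $S^3(l_1,l_2,l_3)$. Then for every integer $k$ with $1\le k\le\kappa(T)$, \[\operatorname{wdim}_k(T)=\sum_{v\in R(T)} f_k(v),\] and moreover the set $S_k(T)=\bigcup_{v\in R(T)}S_k(v)$ is a weak $k$-resolving set of $T$ of minimum cardinality.
   Context: All graphs are finite, simple and connected; $d(u,v)$ is the distance. For vertices $x,y,s$ put $\Delta_s(x,y)=|d(x,s)-d(y,s)|$, $\Delta_S(x,y)=\sum_{s\in S}\Delta_s(x,y)$. For $k\ge1$, $S\subseteq V(G)$ is a weak $k$-resolving set if $\Delta_S(x,y)\ge k$ for all distinct $x,y\in V(G)$; $\operatorname{wdim}_k(G)$ is the minimum size of such a set, and $\kappa(G)$ is the largest $k$ for which one exists. In a tree $T$, for a vertex $v$ of degree $\ge3$, a thread of length $l$ hanging at $v$ is a path $vv_1\cdots v_l$ with $\deg(v_i)=2$ for $1\le i\le l-1$ and $\deg(v_l)=1$. A vertex of degree $\ge 3$ with at least two threads hanging at it is a root vertex; $R(T)$ is the set of root vertices; $\ell(v)$ is the number of threads hanging at $v$. For each root vertex $v$ label the threads hanging at $v$ as $P^{(j)}=vv^{(j)}_1\cdots v^{(j)}_{l_j(v)}$, $1\le j\le \ell(v)$, with $l_1(v)\le\cdots\le l_{\ell(v)}(v)$. $S^3(l_1,l_2,l_3)$ denotes a tree with exactly one root vertex, which has root degree 3 (a subdivision of $K_{1,3}$). Define $f_k(v)=\lceil k/4\rceil\ell(v)-1$ if $\lceil k/4\rceil\le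 l_1(v)$ and $k\equiv1,2\pmod 4$; $f_k(v)=\lceil k/4\rceil\ell(v)$ if $\lceil k/4\rceil\le l_1(v)$ and $k\equiv 3,0\pmod 4$; $f_k(v)=l_1(v)+(\ell(v)-1)(\lceil k/2\rceil-l_1(v))$ if $\lceil k/4\rceil>l_1(v)$. Define $S^{(1)}_k(v)=\{v^{(j)}_i:1\le i\le\lceil k/4\rceil,\ 1\le j\le\ell(v)\}$ and $S^{(2)}_k(v)=\{v^{(1)}_i:1\le i\le l_1(v)\}\cup\{v^{(j)}_i:1\le i\le\lceil k/2\rceil-l_1(v),\ 2\le j\le\ell(v)\}$, and let $S_k(v)=S^{(1)}_k(v)\setminus\{v^{(1)}_{\lceil k/4\rceil}\}$ if $\lceil k/4\rceil\le l_1(v)$ and $k\equiv1,2\pmod4$; $S_k(v)=S^{(1)}_k(v)$ if $\lceil k/4\rceil\le l_1(v)$ and $k\equiv3,0\pmod4$; $S_k(v)=S^{(2)}_k(v)$ if $\lceil k/4\rceil>l_1(v)$. *)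

theory Defs
  imports Complex_Main "HOL-Library.Multiset" "Graph_Theory.Graph_Theory"
begin

text \<open>
  A finite simple graph is a \<^locale>\<open>pair_graph\<close>: a finite, symmetric, loop-free arc relation on a
  finite vertex set, each undirected edge being present as two opposite arcs. In particular
  \<^const>\<open>out_degree\<close> is the number of neighbours.
\<close>

text \<open>
  The library predicates \<^const>\<open>forest\<close> and \<^const>\<open>tree\<close> count the closed walk \<open>a, b, a\<close> as a cycle,
  so no symmetric graph with an edge satisfies them. In a simple graph the undirected cycles are the
  library cycles of length at least 3.
\<close>

definition is_tree :: "'a pair_pre_digraph \<Rightarrow> bool" where
  "is_tree G \<longleftrightarrow> pair_graph G \<and> Digraph_Component.connected (with_proj G) \<and>
     \<not> (\<exists>p. pre_digraph.cycle (with_proj G) p \<and> 3 \<le> length p)"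

text \<open>The one-vertex graph counts as a path.\<close>

definition is_path_graph :: "'a pair_pre_digraph \<Rightarrow> bool" where
  "is_path_graph G \<longleftrightarrow> (\<exists>p. vpath p (with_proj G) \<and> pverts G = set p \<and>
     parcs G = set (vwalk_arcs p) \<union> (set (vwalk_arcs p))\<inverse>)"

definition gdist :: "'a pair_pre_digraph \<Rightarrow> 'a \<Rightarrow> 'a \<Rightarrow> nat" where
  "gdist G u v = (LEAST n. \<exists>p. pre_digraph.awalk (with_proj G) u p v \<and> length p = n)"

definition Delta :: "'a pair_pre_digraph \<Rightarrow> 'a \<Rightarrow> 'a \<Rightarrow> 'a \<Rightarrow> nat" where
  "Delta G s x y = nat \<bar>int (gdist G x s) - int (gdist G y s)\<bar>"

definition Delta_set :: "'a pair_pre_digraph \<Rightarrow> 'a set \<Rightarrow> 'a \<Rightarrow> 'a \<Rightarrow> nat" where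
  "Delta_set G S x y = (\<Sum>s\<in>S. Delta G s x y)"

definition weak_resolving :: "'a pair_pre_digraph \<Rightarrow> nat \<Rightarrow> 'a set \<Rightarrow> bool" where
  "weak_resolving G k S \<longleftrightarrow> S \<subseteq> pverts G \<and>
     (\<forall>x\<in>pverts G. \<forall>y\<in>pverts G. x \<noteq> y \<longrightarrow> k \<le> Delta_set G S x y)"

definition wdim :: "nat \<Rightarrow> 'a pair_pre_digraph \<Rightarrow> nat" where
  "wdim k G = (LEAST m. \<exists>S. weak_resolving G k S \<and> card S = m)"

definition kappa :: "'a pair_pre_digraph \<Rightarrow> nat" where
  "kappa G = (GREATEST k. 1 \<le> k \<and> (\<exists>S. weak_resolving G k S))"

text \<open>
  A thread \<open>v v\<^sub>1 \<dots> v\<^sub>l\<close> is the vertex list \<open>p\<close> that starts with \<open>v\<close> itself, so that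
  \<open>v\<^sub>i = p ! i\<close> and its length \<open>l\<close> is \<open>vwalk_length p\<close>.
\<close>

definition is_thread :: "'a pair_pre_digraph \<Rightarrow> 'a \<Rightarrow> 'a list \<Rightarrow> bool" where
  "is_thread G v p \<longleftrightarrow> 3 \<le> out_degree (with_proj G) v \<and>
     vpath p (with_proj G) \<and> hd p = v \<and> 1 \<le> vwalk_length p \<and>
     (\<forall>i\<in>{1..<vwalk_length p}. out_degree (with_proj G) (p ! i) = 2) \<and>
     out_degree (with_proj G) (p ! vwalk_length p) = 1"

definition threads :: "'a pair_pre_digraph \<Rightarrow> 'a \<Rightarrow> 'a list set" where
  "threads G v = {p. is_thread G v p}"

definition root_degree :: "'a pair_pre_digraph \<Rightarrow> 'a \<Rightarrow> nat" where
  "root_degree G v = card (threads G v)"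

definition root_vertices :: "'a pair_pre_digraph \<Rightarrow> 'a set" where
  "root_vertices G = {v \<in> pverts G. 3 \<le> out_degree (with_proj G) v \<and> 2 \<le> root_degree G v}"

definition is_S3 :: "'a pair_pre_digraph \<Rightarrow> nat \<Rightarrow> nat \<Rightarrow> nat \<Rightarrow> bool" where
  "is_S3 G l1 l2 l3 \<longleftrightarrow> is_tree G \<and>
     (\<exists>v. root_vertices G = {v} \<and> root_degree G v = 3 \<and>
        image_mset vwalk_length (mset_set (threads G v)) = {#l1, l2, l3#})"

text \<open>\<open>P v j\<close> is the \<open>j\<close>-th thread at the root vertex \<open>v\<close>; labels start at 1.\<close>

definition thread_labelling :: "'a pair_pre_digraph \<Rightarrow> ('a \<Rightarrow> nat \<Rightarrow> 'a list) \<Rightarrow> bool" where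
  "thread_labelling G P \<longleftrightarrow> (\<forall>v\<in>root_vertices G.
     bij_betw (P v) {1..root_degree G v} (threads G v) \<and>
     mono_on {1..root_degree G v} (\<lambda>j. vwalk_length (P v j)))"

definition f_val :: "'a pair_pre_digraph \<Rightarrow> ('a \<Rightarrow> nat \<Rightarrow> 'a list) \<Rightarrow> nat \<Rightarrow> 'a \<Rightarrow> nat" where
  "f_val G P k v =
    (let l1 = vwalk_length (P v 1); c4 = nat \<lceil>real k / 4\<rceil>; c2 = nat \<lceil>real k / 2\<rceil> in
     if c4 \<le> l1
     then (if k mod 4 \<in> {1, 2} then c4 * root_degree G v - 1 else c4 * root_degree G v)
     else l1 + (root_degree G v - 1) * (c2 - l1))"

definition S1_set :: "'a pair_pre_digraph \<Rightarrow> ('a \<Rightarrow> nat \<Rightarrow> 'a list) \<Rightarrow> nat \<Rightarrow> 'a \<Rightarrow> 'a set" where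
  "S1_set G P k v =
    {P v j ! i | i j. 1 \<le> i \<and> i \<le> nat \<lceil>real k / 4\<rceil> \<and> 1 \<le> j \<and> j \<le> root_degree G v}"

definition S2_set :: "'a pair_pre_digraph \<Rightarrow> ('a \<Rightarrow> nat \<Rightarrow> 'a list) \<Rightarrow> nat \<Rightarrow> 'a \<Rightarrow> 'a set" where
  "S2_set G P k v =
    {P v 1 ! i | i. 1 \<le> i \<and> i \<le> vwalk_length (P v 1)} \<union>
    {P v j ! i | i j. 1 \<le> i \<and> i \<le> nat \<lceil>real k / 2\<rceil> - vwalk_length (P v 1) \<and>
                      2 \<le> j \<and> j \<le> root_degree G v}"

definition S_root :: "'a pair_pre_digraph \<Rightarrow> ('a \<Rightarrow> nat \<Rightarrow> 'a list) \<Rightarrow> nat \<Rightarrow> 'a \<Rightarrow> 'a set" where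
  "S_root G P k v =
    (let c4 = nat \<lceil>real k / 4\<rceil> in
     if c4 \<le> vwalk_length (P v 1)
     then (if k mod 4 \<in> {1, 2} then S1_set G P k v - {P v 1 ! c4} else S1_set G P k v)
     else S2_set G P k v)"

definition S_tree :: "'a pair_pre_digraph \<Rightarrow> ('a \<Rightarrow> nat \<Rightarrow> 'a list) \<Rightarrow> nat \<Rightarrow> 'a set" where
  "S_tree G P k = (\<Union>v\<in>root_vertices G. S_root G P k v)"

lemma finite_threads:
  assumes "pair_graph G"
  shows "finite (threads G v)"
proof (rule finite_subset)
  interpret pair_graph G by fact
  show "threads G v \<subseteq> {xs. set xs \<subseteq> pverts G \<and> distinct xs}"
    by (auto simp: threads_def is_thread_def vpath_def vwalk_def)
  show "finite {xs. set xs \<subseteq> pverts G \<and> distinct xs}"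
    by (rule finite_subset_distinct) (rule pair_finite_verts)
qed

text \<open>Every graph has a labelling, so assuming one is no restriction.\<close>

lemma thread_labelling_exists:
  assumes "pair_graph G"
  shows "\<exists>P. thread_labelling G P"
proof -
  have "\<exists>f. bij_betw f {1..root_degree G v} (threads G v) \<and>
     mono_on {1..root_degree G v} (\<lambda>j. vwalk_length (f j))" for v
  proof -
    obtain ys where ys: "set ys = threads G v" "distinct ys"
      using finite_distinct_list[OF finite_threads[OF assms]] by blast
    define xs where "xs = sort_key vwalk_length ys"
    have xs: "set xs = threads G v" "distinct xs" "sorted (map vwalk_length xs)"
      using ys by (auto simp: xs_def)
    have len: "length xs = root_degree G v"
      unfolding root_degree_def using xs distinct_card by metis
    have "bij_betw (\<lambda>j. j - 1) {1..root_degree G v} {..<length xs}"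
      unfolding len by (rule bij_betw_byWitness[where f' = Suc]) auto
    moreover have "bij_betw ((!) xs) {..<length xs} (threads G v)"
      using xs by (intro bij_betw_nth) auto
    ultimately have "bij_betw (\<lambda>j. xs ! (j - 1)) {1..root_degree G v} (threads G v)"
      using bij_betw_trans[unfolded comp_def] by blast
    moreover have "mono_on {1..root_degree G v} (\<lambda>j. vwalk_length (xs ! (j - 1)))"
    proof (rule mono_onI)
      fix r s assume *: "r \<in> {1..root_degree G v}" "s \<in> {1..root_degree G v}" "r \<le> s"
      have "map vwalk_length xs ! (r - 1) \<le> map vwalk_length xs ! (s - 1)"
        using * len by (intro sorted_nth_mono[OF xs(3)]) auto
      then show "vwalk_length (xs ! (r - 1)) \<le> vwalk_length (xs ! (s - 1))"
        using * len by simp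
    qed
    ultimately show ?thesis by blast
  qed
  then have "\<exists>P. \<forall>v. bij_betw (P v) {1..root_degree G v} (threads G v) \<and>
     mono_on {1..root_degree G v} (\<lambda>j. vwalk_length (P v j))"
    by metis
  then show ?thesis unfolding thread_labelling_def by blast
qed

end

theory Submission
  imports Defs
begin

text \<open>
  For two threads at a root vertex \<open>v\<close>, the two neighbours of \<open>v\<close> on them are only resolved by
  vertices of these threads, each contributing 2. So a weak \<open>k\<close>-resolving set has at least
  \<open>\<lceil>k/2\<rceil>\<close> vertices on any two threads at \<open>v\<close>, and minimising the number of vertices under
  these constraints gives \<open>f\<^sub>k(v)\<close>; threads at different root vertices are disjoint.

  Conversely, let \<open>S\<close> have at least \<open>\<lceil>k/2\<rceil>\<close> vertices on any two threads at a common root vertex.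
  If \<open>d(x, y)\<close> is odd, every vertex of \<open>S\<close> contributes at least 1, and \<open>|S| \<ge> k\<close> because there are two
  root vertices or one with four threads. If \<open>d(x, y)\<close> is even, let \<open>w\<close> be the midpoint of the path
  from \<open>x\<close> to \<open>y\<close>. Every vertex of the branches at \<open>w\<close> containing \<open>x\<close> and \<open>y\<close> contributes at least
  2. If one of these branches contains a vertex of degree at least 3, then such a vertex farthest
  from \<open>w\<close> is a root vertex with two threads inside the branch; otherwise the two branches are
  themselves threads at \<open>w\<close>, since the tree is not a path.
\<close>

section \<open>Auxiliary facts on maxima, multisets and rounding\<close>

lemma ex_max_nat:
  fixes f :: "'b \<Rightarrow> nat"
  assumes "finite X" "X \<noteq> {}"
  shows "\<exists>z\<in>X. \<forall>y\<in>X. f y \<le> f z"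
proof -
  have "Max (f ` X) \<in> f ` X" using assms by (intro Max_in) auto
  then obtain z where "z \<in> X" "f z = Max (f ` X)" by auto
  then show ?thesis using assms by (intro bexI[of _ z]) auto
qed

lemma size_mset_3:
  assumes "size M = 3"
  shows "\<exists>a b c. M = {#a, b, c#}"
proof -
  obtain a N where N: "M = add_mset a N" using assms size_eq_Suc_imp_eq_union[of M 2] by auto
  then obtain b K where K: "N = add_mset b K" using assms size_eq_Suc_imp_eq_union[of N 1] by auto
  then have "size K = 1" using assms N by simp
  then obtain c where "K = {#c#}" using size_1_singleton_mset by blast
  then show ?thesis using N K by blast
qed

text \<open>Replaces the real ceilings in \<open>f_val\<close>, \<open>S1_set\<close> and
  \<open>S2_set\<close> by division of natural numbers, which the arithmetic procedures
  handle.\<close>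

lemma ceiling_div: "0 < m \<Longrightarrow> nat \<lceil>real k / real m\<rceil> = (k + m - 1) div m"
proof -
  assume m: "0 < m"
  define q where "q = (k + m - 1) div m"
  have 1: "q * m \<le> k + m - 1" unfolding q_def by (rule div_times_less_eq_dividend)
  have 2: "k + m - 1 < q * m + m"
    unfolding q_def using dividend_less_div_times[OF m] by (simp add: add.commute)
  have "q * m < k + m" "k \<le> q * m" using 1 2 m by linarith+
  then have "real (q * m) < real (k + m)" "real k \<le> real (q * m)"
    by (simp_all only: of_nat_less_iff of_nat_le_iff)
  then have "\<lceil>real k / real m\<rceil> = int q"
    using m by (intro ceiling_unique) (simp_all add: field_simps)
  then show "nat \<lceil>real k / real m\<rceil> = (k + m - 1) div m" by (simp add: q_def)
qed

text \<open>The constraint on a pair of threads is k/2 rounded up. In these residue classes it is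
  still met when one of two threads carries one vertex fewer than k/4 rounded up; this is the source
  of the -1 in \<open>f_val\<close>.\<close>

lemma half_quarter_odd:
  "k mod 4 \<in> {1, 2} \<Longrightarrow> (k + 1) div 2 + 1 = 2 * ((k + 3) div 4)" for k :: nat
  by simp presburger

lemma half_quarter_even:
  "k mod 4 \<notin> {1, 2} \<Longrightarrow> (k + 1) div 2 = 2 * ((k + 3) div 4)" for k :: nat
  by simp presburger

section \<open>Trees: neighbours, degrees and connectedness\<close>

locale simple_tree = pair_graph G for G :: "'a pair_pre_digraph" +
  assumes is_tree: "is_tree G"
begin

abbreviation V where "V \<equiv> pverts G"
abbreviation E where "E \<equiv> parcs G"
abbreviation d where "d \<equiv> gdist G"

definition nbrs where "nbrs u = {v. (u, v) \<in> E}"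
definition deg where "deg u = card (nbrs u)"

lemma E_sym: "(u, v) \<in> E \<Longrightarrow> (v, u) \<in> E"
  by (rule arcs_symmetric)

lemma E_in_V: "(u, v) \<in> E \<Longrightarrow> u \<in> V" "(u, v) \<in> E \<Longrightarrow> v \<in> V"
  using in_arcsD1 in_arcsD2 by auto

lemma E_neq: "(u, v) \<in> E \<Longrightarrow> u \<noteq> v"
  by (rule no_loops')

lemma nbrs_subset: "nbrs u \<subseteq> V"
  using E_in_V by (auto simp: nbrs_def)

lemma finite_nbrs: "finite (nbrs u)"
  using nbrs_subset pair_finite_verts finite_subset by blast

lemma out_degree_eq: "out_degree (with_proj G) u = deg u"
proof -
  have "out_arcs (with_proj G) u = Pair u ` nbrs u"
    by (auto simp: out_arcs_def nbrs_def)
  then show ?thesis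
    by (simp add: out_degree_def deg_def card_image inj_on_def)
qed

lemma V_nonempty: "V \<noteq> {}"
  using is_tree unfolding is_tree_def Digraph_Component.connected_def
    strongly_connected_def mk_symmetric_def by simp

lemma walk_ex:
  assumes "u \<in> V" "v \<in> V"
  shows "\<exists>p. awalk u p v"
proof -
  have "u \<rightarrow>\<^sup>*\<^bsub>with_proj (mk_symmetric (with_proj G))\<^esub> v"
    using is_tree assms unfolding is_tree_def Digraph_Component.connected_def
      strongly_connected_def by (simp add: mk_symmetric_def)
  then have "u \<rightarrow>\<^sup>*\<^bsub>with_proj G\<^esub> v"
    using reachable_mk_symmetric_eq[OF pair_sym_arcs] by simp
  then show ?thesis
    using reachable_awalk by blast
qed

subsection \<open>Distances\<close>

lemma dist_le: "awalk u p v \<Longrightarrow> d u v \<le> length p"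
  unfolding gdist_def by (rule Least_le) auto

lemma dist_walk:
  assumes "u \<in> V" "v \<in> V"
  obtains p where "awalk u p v" "length p = d u v"
proof -
  have "\<exists>n p. awalk u p v \<and> length p = n" using walk_ex[OF assms] by auto
  then have "\<exists>p. awalk u p v \<and> length p = d u v"
    unfolding gdist_def by (rule LeastI_ex)
  then show ?thesis using that by auto
qed

lemma dist_self: "u \<in> V \<Longrightarrow> d u u = 0"
  using dist_le[of u "[]" u] by (simp add: awalk_Nil_iff)

lemma dist_0: "u \<in> V \<Longrightarrow> v \<in> V \<Longrightarrow> d u v = 0 \<longleftrightarrow> u = v"
  by (metis awalk_Nil_iff dist_self dist_walk length_0_conv)

lemma dist_sym_le: "u \<in> V \<Longrightarrow> v \<in> V \<Longrightarrow> d v u \<le> d u v"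
proof -
  assume "u \<in> V" "v \<in> V"
  then obtain p where "awalk u p v" "length p = d u v" by (rule dist_walk)
  moreover have "length (rev_path p) = length p"
    by (induction p) auto
  ultimately show ?thesis using dist_le[of v "rev_path p" u] by simp
qed

lemma dist_sym: "u \<in> V \<Longrightarrow> v \<in> V \<Longrightarrow> d u v = d v u"
  by (simp add: dist_sym_le le_antisym)

lemma dist_triangle:
  assumes "u \<in> V" "v \<in> V" "w \<in> V"
  shows "d u w \<le> d u v + d v w"
proof -
  obtain p q where "awalk u p v" "length p = d u v" "awalk v q w" "length q = d v w"
    using assms dist_walk by metis
  then show ?thesis using dist_le[of u "p @ q" w] awalk_appendI by fastforce
qed

lemma dist_E: "(u, v) \<in> E \<Longrightarrow> d u v = 1"
proof -
  assume uv: "(u, v) \<in> E"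
  then have "d u v \<le> 1"
    using dist_le[of u "[(u, v)]" v] E_in_V by (simp add: awalk_Cons_iff awalk_Nil_iff)
  moreover have "d u v \<noteq> 0" using uv E_neq E_in_V dist_0 by blast
  ultimately show ?thesis by simp
qed

lemma dist_E_le: "(u, u') \<in> E \<Longrightarrow> v \<in> V \<Longrightarrow> d u v \<le> Suc (d u' v)"
  using dist_triangle[of u u' v] dist_E[of u u'] E_in_V by simp

lemma dist_step:
  assumes "u \<in> V" "v \<in> V" "d u v = Suc n"
  obtains u' where "(u, u') \<in> E" "d u' v = n"
proof -
  obtain p where p: "awalk u p v" "length p = Suc n" using dist_walk assms by metis
  then obtain e q where q: "p = e # q" by (cases p) auto
  then have e: "(u, snd e) \<in> E" and w: "awalk (snd e) q v"
    using p by (auto simp: awalk_Cons_iff)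
  have "d (snd e) v \<le> n" using dist_le[OF w] p q by simp
  moreover have "Suc n \<le> Suc (d (snd e) v)" using dist_E_le[OF e assms(2)] assms(3) by simp
  ultimately show ?thesis using that e by auto
qed

section \<open>Absence of cycles and its consequences for distances\<close>

lemma vwalk_awalk:
  assumes "vwalk p (with_proj G)"
  shows "awalk (hd p) (vwalk_arcs p) (last p) \<and> awalk_verts (hd p) (vwalk_arcs p) = p"
  using assms
  by (induction p rule: vwalk_induct) (auto simp: awalk_Nil_iff awalk_Cons_iff)

text \<open>Closing the path with the arc from its last vertex to its head gives a cycle of length
  at least 3. Acyclicity enters the distance arguments through this lemma.\<close>

lemma no_closed_vpath:
  assumes "vpath p (with_proj G)" "3 \<le> length p" "(last p, hd p) \<in> E"
  shows False
proof -
  let ?q = "p @ [hd p]"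
  have ne: "p \<noteq> []" using assms(2) by auto
  have "vwalk ?q (with_proj G)"
    using assms ne by (auto simp: vpath_def vwalk_def vwalk_arcs_append)
  note w = vwalk_awalk[OF this]
  have "distinct (tl ?q)" using assms(1) ne by (cases p) (auto simp: vpath_def)
  moreover have len: "length (vwalk_arcs ?q) = length p"
    using vwalk_length_simp[of ?q] unfolding vwalk_length_def by simp
  ultimately have "cycle (vwalk_arcs ?q)"
    using w ne unfolding cycle_def by (intro exI[of _ "hd p"]) (auto simp del: vwalk_arcs_Cons)
  then show False using is_tree assms(2) len unfolding is_tree_def by auto
qed

text \<open>Descend from both ends towards \<open>b\<close>, one level at a time, until the descents
  meet. All inner vertices lie strictly below level \<open>n\<close>, so attaching the two ends of
  the next level keeps the path simple. For \<open>n = 0\<close> both ends would equal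
  \<open>b\<close>.\<close>

lemma level_path:
  assumes "u \<in> V" "u' \<in> V" "b \<in> V" "u \<noteq> u'" "d u b = n" "d u' b = n"
  shows "\<exists>p. vpath p (with_proj G) \<and> hd p = u \<and> last p = u' \<and> 3 \<le> length p \<and>
    (\<forall>x\<in>set p. x = u \<or> x = u' \<or> d x b < n)"
  using assms
proof (induction n arbitrary: u u')
  case 0
  then show ?case using dist_0 by auto
next
  case (Suc n)
  obtain t where t: "(u, t) \<in> E" "d t b = n" using dist_step Suc.prems by metis
  obtain t' where t': "(u', t') \<in> E" "d t' b = n" using dist_step Suc.prems by metis
  note VV = E_in_V[OF t(1)] E_in_V[OF t'(1)]
  show ?case
  proof (cases "t = t'")
    case True
    then have "vpath [u, t, u'] (with_proj G)"
      using t t' VV Suc.prems E_sym E_neq by (auto simp: vpath_def vwalk_def)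
    then show ?thesis using t by (intro exI[of _ "[u, t, u']"]) auto
  next
    case False
    obtain p where p: "vpath p (with_proj G)" "hd p = t" "last p = t'" "3 \<le> length p"
      "\<forall>x\<in>set p. x = t \<or> x = t' \<or> d x b < n"
      using Suc.IH[of t t'] False t t' VV Suc.prems(3) by blast
    have ne: "p \<noteq> []" using p(4) by auto
    have lt: "\<forall>x\<in>set p. d x b < Suc n" using p(5) t t' by auto
    then have "u \<notin> set p" "u' \<notin> set p" using Suc.prems by auto
    then have "vpath (u # p @ [u']) (with_proj G)"
      using p ne t t' VV Suc.prems(4) E_sym by (auto simp: vpath_def vwalk_def vwalk_arcs_append)
    then show ?thesis using lt p(4)
      by (intro exI[of _ "u # p @ [u']"]) auto
  qed
qed

text \<open>An edge inside a level would close the path of \<open>level_path\<close> to a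
  cycle.\<close>

lemma dist_E_neq:
  assumes "(s, t) \<in> E" "b \<in> V"
  shows "d s b \<noteq> d t b"
proof
  assume "d s b = d t b"
  then obtain p where "vpath p (with_proj G)" "hd p = s" "last p = t" "3 \<le> length p"
    using level_path[of s t b "d t b"] assms E_in_V E_neq by blast
  then show False using no_closed_vpath assms E_sym by blast
qed

text \<open>Rooted at \<open>b\<close>, a vertex has at most one parent: two parents are joined by a
  path below \<open>s\<close>, and \<open>s\<close> would close it to a cycle.\<close>

lemma parent_unique:
  assumes "(s, u) \<in> E" "(s, u') \<in> E" "b \<in> V" "d u b < d s b" "d u' b < d s b"
  shows "u = u'"
proof (rule ccontr)
  assume "u \<noteq> u'"
  have eq: "d s b = Suc (d u b)" "d s b = Suc (d u' b)"
    using dist_E_le[OF assms(1,3)] dist_E_le[OF assms(2,3)] assms by auto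
  then obtain p where p: "vpath p (with_proj G)" "hd p = u" "last p = u'" "3 \<le> length p"
      "\<forall>x\<in>set p. x = u \<or> x = u' \<or> d x b < d u b"
    using level_path[of u u' b "d u b"] assms E_in_V \<open>u \<noteq> u'\<close> by auto
  have ne: "p \<noteq> []" using p(4) by auto
  have "s \<notin> set p" using p(5) eq by auto
  then have "vpath (s # p) (with_proj G)"
    using p assms E_in_V ne by (auto simp: vpath_def vwalk_def)
  then show False using no_closed_vpath[of "s # p"] p ne assms E_sym by auto
qed

lemma dist_E_cases:
  assumes "(s, t) \<in> E" "b \<in> V"
  shows "d s b = Suc (d t b) \<or> d t b = Suc (d s b)"
  using dist_E_neq[OF assms] dist_E_le[OF assms] dist_E_le[OF E_sym[OF assms(1)] assms(2)] by linarith

text \<open>Trees are bipartite: along a geodesic from \<open>x\<close> to \<open>y\<close>, each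
  edge changes the distance to \<open>s\<close> by exactly 1.\<close>

lemma parity:
  assumes "x \<in> V" "y \<in> V" "s \<in> V"
  shows "even (d x s + d y s) \<longleftrightarrow> even (d x y)"
  using assms
proof (induction "d x y" arbitrary: x)
  case 0
  then have "x = y" using dist_0 by metis
  then show ?case using dist_self 0 by simp
next
  case (Suc n)
  obtain x' where x': "(x, x') \<in> E" "d x' y = n" using dist_step Suc by metis
  have "even (d x' s + d y s) \<longleftrightarrow> even (d x' y)"
    using Suc.hyps(1)[of x'] x' Suc.prems E_in_V by blast
  then show ?case
    using dist_E_cases[OF x'(1) \<open>s \<in> V\<close>] x'(2) Suc.hyps(2) by (metis even_Suc add_Suc)
qed

subsection \<open>Branches\<close>

text \<open>For an edge from \<open>w\<close> to \<open>a\<close> this is the component of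
  \<open>a\<close> after deletion of that edge. The description by distances makes membership a
  matter of arithmetic.\<close>

definition branch where "branch w a = {s \<in> V. d a s < d w s}"

lemma branch_subset: "branch w a \<subseteq> V"
  by (auto simp: branch_def)

lemma finite_branch: "finite (branch w a)"
  using branch_subset pair_finite_verts finite_subset by blast

lemma branch_self: "(w, a) \<in> E \<Longrightarrow> a \<in> branch w a"
  using dist_E[of w a] dist_self[of a] E_in_V by (simp add: branch_def)

lemma not_in_branch: "w \<notin> branch w a"
  using dist_self by (auto simp: branch_def)

lemma branch_dist:
  assumes "(w, a) \<in> E" "s \<in> branch w a"
  shows "d w s = Suc (d a s)"
  using assms dist_E_le[OF assms(1), of s] by (auto simp: branch_def)

lemma not_branch_dist:
  assumes "(w, a) \<in> E" "s \<in> V" "s \<notin> branch w a"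
  shows "d a s = Suc (d w s)"
  using dist_E_cases[OF assms(1,2)] assms by (auto simp: branch_def)

text \<open>The edge between \<open>w\<close> and \<open>a\<close> is the only one leaving the
  branch. For any other leaving edge, both \<open>t\<close> and the next vertex from
  \<open>s\<close> towards \<open>a\<close> would be parents of \<open>s\<close> with respect to
  \<open>w\<close>, hence equal, which contradicts their distances to \<open>a\<close>.\<close>

lemma branch_edge:
  assumes "(w, a) \<in> E" "(s, t) \<in> E" "s \<in> branch w a" "t \<notin> branch w a"
  shows "s = a \<and> t = w"
proof -
  note VV = E_in_V[OF assms(1)] E_in_V[OF assms(2)]
  note sy = dist_sym[OF VV(1) VV(3)] dist_sym[OF VV(2) VV(3)] dist_sym[OF VV(1) VV(4)] dist_sym[OF VV(2) VV(4)]
  have 1: "d s w = Suc (d s a)" using branch_dist[OF assms(1,3)] sy by simp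
  have 2: "d t a = Suc (d t w)" using not_branch_dist[OF assms(1) VV(4) assms(4)] sy by simp
  have 3: "d s a = d t w"
    using dist_E_le[OF assms(2) VV(1)] dist_E_le[OF E_sym[OF assms(2)] VV(2)] 1 2 by simp
  have "d s a = 0"
  proof (rule ccontr)
    assume "d s a \<noteq> 0"
    then obtain m where m: "d s a = Suc m" using not0_implies_Suc by blast
    obtain s' where s': "(s, s') \<in> E" "d s' a = m" using dist_step[OF VV(3,2) m] .
    have "d s' w \<le> Suc m"
      using dist_triangle[OF E_in_V(2)[OF s'(1)] VV(2,1)] s' dist_E[OF E_sym[OF assms(1)]] by simp
    then have "d s' w < d s w" using 1 m by simp
    then have "s' = t" using parent_unique[OF s'(1) assms(2) VV(1)] 1 3 by simp
    then show False using s' 2 3 m by simp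
  qed
  then show ?thesis using 3 dist_0 VV by metis
qed

text \<open>A geodesic from \<open>s\<close> to \<open>t\<close> has to leave the branch, and by
  \<open>branch_edge\<close> it can do so only by stepping onto \<open>w\<close>.\<close>

lemma dist_via:
  assumes "(w, a) \<in> E" "s \<in> branch w a" "t \<in> V" "t \<notin> branch w a"
  shows "d s t = d s w + d w t"
  using assms(2)
proof (induction "d s t" arbitrary: s)
  case 0
  then show ?case using dist_0 branch_subset assms by (metis subsetD)
next
  case (Suc n)
  have sV: "s \<in> V" using Suc.prems branch_subset by auto
  obtain s' where s': "(s, s') \<in> E" "d s' t = n" using dist_step[OF sV assms(3)] Suc.hyps(2) by metis
  have wV: "w \<in> V" using assms E_in_V by auto
  have "d s t \<ge> d s w + d w t"
  proof (cases "s' \<in> branch w a")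
    case True
    then have "d s' t = d s' w + d w t" using Suc.hyps s' by auto
    moreover have "d s w \<le> Suc (d s' w)" using dist_E_le s' wV by auto
    ultimately show ?thesis using s' Suc.hyps(2) by simp
  next
    case False
    then have "s' = w" using branch_edge[OF assms(1) s'(1) Suc.prems] by auto
    then show ?thesis using s' Suc.hyps(2) dist_E[OF s'(1)] by simp
  qed
  then show ?case using dist_triangle[OF sV wV assms(3)] by simp
qed

text \<open>A common vertex would have both \<open>a\<close> and \<open>b\<close> as neighbours of
  \<open>w\<close> closer to it, against \<open>parent_unique\<close>.\<close>

lemma branch_disjoint:
  assumes "(w, a) \<in> E" "(w, b) \<in> E" "a \<noteq> b"
  shows "branch w a \<inter> branch w b = {}"
  using parent_unique[OF assms(1,2)] assms(3) by (auto simp: branch_def)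

lemma branch_cover:
  assumes "w \<in> V"
  shows "V = insert w (\<Union>a\<in>nbrs w. branch w a)"
proof -
  have "s \<in> (\<Union>a\<in>nbrs w. branch w a)" if s: "s \<in> V" "s \<noteq> w" for s
  proof -
    have "d w s \<noteq> 0" using s assms dist_0 by auto
    then obtain m where m: "d w s = Suc m" using not0_implies_Suc by blast
    obtain a where "(w, a) \<in> E" "d a s = m" using dist_step[OF assms s(1) m] .
    then show ?thesis using m s by (auto simp: nbrs_def branch_def)
  qed
  then show ?thesis using assms branch_subset by blast
qed

text \<open>No vertex is equidistant from the ends of an edge, so the two sides of the edge
  partition the tree.\<close>

lemma opposite_branches:
  assumes "(w, a) \<in> E"
  shows "s \<in> branch a w \<longleftrightarrow> s \<in> V \<and> s \<notin> branch w a"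
  using dist_E_neq[OF assms, of s] by (auto simp: branch_def)

text \<open>The geodesic from \<open>s\<close> back to \<open>w\<close> passes through
  \<open>z\<close>, so moving from \<open>z\<close> away from \<open>w\<close> stays inside the
  branch and increases the distance.\<close>

lemma branch_mono:
  assumes "(w, a) \<in> E" "z \<in> branch w a" "(z, b) \<in> E" "d z w < d b w" "s \<in> branch z b"
  shows "s \<in> branch w a" "d s w > d z w"
proof -
  have VV: "w \<in> V" "a \<in> V" "z \<in> V" "b \<in> V" "s \<in> V"
    using assms E_in_V branch_subset by blast+
  have "w \<notin> branch z b" using assms(4) by (auto simp: branch_def)
  from dist_via[OF assms(3,5) VV(1) this] have 1: "d s w = d s z + d z w" .
  have "d a s \<le> d a z + d z s" using dist_triangle VV by simp
  moreover have "d w z = Suc (d a z)" using branch_dist assms by simp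
  moreover have "d s z > 0" using dist_0 VV assms(5) not_in_branch by (metis gr0I)
  ultimately show "s \<in> branch w a" "d s w > d z w"
    using 1 VV dist_sym[OF VV(5,1)] dist_sym[OF VV(5,3)] dist_sym[OF VV(3,1)]
    by (auto simp: branch_def)
qed

text \<open>The recursion behind the analysis of threads: from \<open>a\<close>, every direction
  except the one back to \<open>u\<close> stays in the branch.\<close>

lemma branch_step:
  assumes "(u, a) \<in> E"
  shows "branch u a = insert a (\<Union>b\<in>nbrs a - {u}. branch a b)"
proof -
  have aV: "a \<in> V" using assms E_in_V by auto
  have "V = insert a (branch a u \<union> (\<Union>b\<in>nbrs a - {u}. branch a b))"
    using branch_cover[OF aV] assms E_sym by (auto simp: nbrs_def)
  moreover have "branch a u \<inter> branch a b = {}" if "b \<in> nbrs a - {u}" for b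
    using branch_disjoint[of a u b] assms E_sym that by (auto simp: nbrs_def)
  moreover have "a \<notin> branch a u" by (rule not_in_branch)
  ultimately show ?thesis
    using opposite_branches[OF E_sym[OF assms]] branch_subset[of u a] by blast
qed

subsection \<open>Threads\<close>

text \<open>A thread without its starting vertex \<open>u\<close>. The degree of \<open>u\<close> is
  left open, so that the tail of a leg is again a leg and structural induction applies.\<close>

inductive leg :: "'a \<Rightarrow> 'a \<Rightarrow> 'a list \<Rightarrow> bool" where
  leg_end: "(u, a) \<in> E \<Longrightarrow> deg a = 1 \<Longrightarrow> leg u a [a]"
| leg_step: "(u, a) \<in> E \<Longrightarrow> deg a = 2 \<Longrightarrow> (a, b) \<in> E \<Longrightarrow> b \<noteq> u \<Longrightarrow> leg a b xs \<Longrightarrow> leg u a (a # xs)"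

lemma leg_hd: "leg u a xs \<Longrightarrow> hd xs = a \<and> xs \<noteq> [] \<and> (u, a) \<in> E"
  by (induction rule: leg.induct) auto

lemma nbrs_deg_1:
  assumes "(u, a) \<in> E" "deg a = 1"
  shows "nbrs a = {u}"
proof -
  obtain x where "nbrs a = {x}" using assms(2) unfolding deg_def by (rule card_1_singletonE)
  moreover have "u \<in> nbrs a" using assms E_sym by (simp add: nbrs_def)
  ultimately show ?thesis by auto
qed

lemma nbrs_deg_2:
  assumes "(u, a) \<in> E" "deg a = 2" "(a, b) \<in> E" "b \<noteq> u"
  shows "nbrs a = {u, b}"
proof -
  have "{u, b} \<subseteq> nbrs a" using assms E_sym by (simp add: nbrs_def)
  then show ?thesis
    using assms finite_nbrs card_subset_eq[of "nbrs a" "{u, b}"] unfolding deg_def by auto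
qed

text \<open>A thread fills the whole branch of its first edge, which makes the distance lemmas for
  branches available for threads.\<close>

lemma leg_set: "leg u a xs \<Longrightarrow> set xs = branch u a"
proof (induction rule: leg.induct)
  case (leg_end u a)
  then show ?case using branch_step nbrs_deg_1 by simp
next
  case (leg_step u a b xs)
  have "nbrs a - {u} = {b}" using nbrs_deg_2[OF leg_step.hyps(1-4)] leg_step.hyps(4) by auto
  then show ?case using branch_step[OF leg_step.hyps(1)] leg_step.IH by simp
qed

lemma leg_degrees:
  "leg u a xs \<Longrightarrow> i < length xs \<Longrightarrow> deg (xs ! i) = (if Suc i = length xs then 1 else 2)"
proof (induction arbitrary: i rule: leg.induct)
  case (leg_step u a b xs)
  moreover have "xs \<noteq> []" using leg_hd leg_step by auto
  ultimately show ?case by (cases i) auto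
qed auto

lemma leg_deg_le:
  assumes "leg u a xs" "s \<in> branch u a"
  shows "deg s \<le> 2"
proof -
  obtain i where "i < length xs" "s = xs ! i"
    using assms leg_set[OF assms(1)] by (metis in_set_conv_nth)
  then show ?thesis using leg_degrees[OF assms(1), of i] by simp
qed

lemma leg_vpath: "leg u a xs \<Longrightarrow> vpath (u # xs) (with_proj G)"
proof (induction rule: leg.induct)
  case (leg_end u a)
  then show ?case using E_in_V E_neq by (auto simp: vpath_def vwalk_def)
next
  case (leg_step u a b xs)
  have "leg u a (a # xs)" using leg_step leg.leg_step by blast
  then have "u \<notin> set (a # xs)" using leg_set not_in_branch by metis
  then show ?case using leg_step E_in_V by (auto simp: vpath_def vwalk_def)
qed

text \<open>After the first step a leg has no choice, since its inner vertices have only one way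
  onwards. Hence a thread is determined by its first edge.\<close>

lemma leg_unique: "leg u a xs \<Longrightarrow> leg u a ys \<Longrightarrow> xs = ys"
proof (induction arbitrary: ys rule: leg.induct)
  case (leg_end u a)
  from leg_end(3) show ?case by cases (use leg_end(2) in auto)
next
  case (leg_step u a b xs)
  have n: "nbrs a = {u, b}" using nbrs_deg_2 leg_step.hyps by blast
  from leg_step.prems show ?case
  proof cases
    case leg_end
    then show ?thesis using leg_step.hyps(2) by simp
  next
    case (leg_step b' xs')
    have "b' \<in> nbrs a" using leg_step(4) by (simp add: nbrs_def)
    then have "b' = b" using n leg_step(5) by blast
    then have "xs = xs'" using leg_step(6) leg_step.IH by blast
    then show ?thesis using leg_step(1) by simp
  qed
qed

lemma leg_arcs:
  assumes "leg u a xs" "(s, t) \<in> E" "s \<in> insert u (branch u a)" "t \<in> insert u (branch u a)"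
  shows "(s, t) \<in> set (vwalk_arcs (u # xs)) \<union> (set (vwalk_arcs (u # xs)))\<inverse>"
  using assms
proof (induction rule: leg.induct)
  case (leg_end u a)
  then have "branch u a = {a}" using leg_set[OF leg.leg_end] by auto
  then show ?case using leg_end E_neq by auto
next
  case (leg_step u a b xs)
  have ne: "xs \<noteq> []" "hd xs = b" using leg_hd leg_step.hyps by auto
  have br: "branch u a = insert a (branch a b)"
    using leg_set[OF leg.leg_step[OF leg_step.hyps]] leg_set[OF leg_step.hyps(5)] by simp
  show ?case
  proof (cases "s = u \<or> t = u")
    case True
    then have "s = u \<and> t \<in> branch u a \<or> t = u \<and> s \<in> branch u a"
      using leg_step.prems E_neq by auto
    then have "s = u \<and> t = a \<or> t = u \<and> s = a"
      using branch_edge[OF leg_step.hyps(1)] leg_step.prems(1) E_sym not_in_branch by metis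
    then show ?thesis using ne by auto
  next
    case False
    then have "(s, t) \<in> set (vwalk_arcs (a # xs)) \<union> (set (vwalk_arcs (a # xs)))\<inverse>"
      using leg_step br by auto
    then show ?thesis by auto
  qed
qed

text \<open>Induction on the size of the branch: a vertex of degree at most 2 entered from
  \<open>u\<close> is a leaf or has exactly one further neighbour, whose branch is smaller.\<close>

lemma leg_exists:
  assumes "(u, a) \<in> E" "\<forall>s\<in>branch u a. deg s \<le> 2"
  shows "\<exists>xs. leg u a xs"
  using assms
proof (induction "card (branch u a)" arbitrary: u a rule: less_induct)
  case less
  have "deg a \<le> 2" using less branch_self by auto
  moreover have u: "u \<in> nbrs a" using less.prems E_sym by (auto simp: nbrs_def)
  then have "deg a \<noteq> 0" using finite_nbrs by (auto simp: deg_def)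
  ultimately consider "deg a = 1" | "deg a = 2" by linarith
  then show ?case
  proof cases
    case 1
    then show ?thesis using leg_end less.prems by blast
  next
    case 2
    then have "nbrs a \<noteq> {u}" by (auto simp: deg_def)
    then obtain b where b: "b \<in> nbrs a" "b \<noteq> u" using u by blast
    then have ab: "(a, b) \<in> E" by (simp add: nbrs_def)
    have br: "branch u a = insert a (branch a b)"
      using branch_step[OF less.prems(1)] nbrs_deg_2[OF less.prems(1) 2 ab b(2)] b(2) by auto
    have "card (branch a b) < card (branch u a)"
      using br not_in_branch[of a b] finite_branch by simp
    then obtain xs where "leg a b xs" using less ab br by blast
    then show ?thesis using leg_step less.prems 2 ab b by blast
  qed
qed

lemma is_leg:
  assumes "vpath (u # a # ys) (with_proj G)"
    "\<And>i. i \<le> length ys \<Longrightarrow> deg ((a # ys) ! i) = (if i = length ys then 1 else 2)"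
  shows "leg u a (a # ys)"
  using assms
proof (induction ys arbitrary: u a)
  case Nil
  then show ?case using Nil(2)[of 0] by (auto intro: leg_end simp: vpath_def vwalk_def)
next
  case (Cons b ys)
  have "leg a b (b # ys)"
  proof (rule Cons.IH)
    show "vpath (a # b # ys) (with_proj G)" using Cons.prems by (auto simp: vpath_def vwalk_def)
    show "deg ((b # ys) ! i) = (if i = length ys then 1 else 2)" if "i \<le> length ys" for i
      using Cons.prems(2)[of "Suc i"] that by simp
  qed
  moreover have "deg a = 2" using Cons.prems(2)[of 0] by simp
  ultimately show ?case
    using Cons.prems(1) by (intro leg_step[of u a b]) (auto simp: vpath_def vwalk_def)
qed

text \<open>Links the index-based definition of threads with the recursive \<open>leg\<close>, on
  which the later arguments rely.\<close>

lemma thread_iff: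
  "p \<in> threads G v \<longleftrightarrow> 3 \<le> deg v \<and> (\<exists>a xs. p = v # xs \<and> leg v a xs)"
proof
  assume "p \<in> threads G v"
  then have p: "3 \<le> deg v" "vpath p (with_proj G)" "hd p = v" "1 \<le> length p - 1"
    "\<forall>i\<in>{1..<length p - 1}. deg (p ! i) = 2" "deg (p ! (length p - 1)) = 1"
    by (auto simp: threads_def is_thread_def out_degree_eq)
  obtain v' q where q: "p = v' # q" using p(4) by (cases p) auto
  obtain a ys where "q = a # ys" using p(4) q by (cases q) auto
  then have e: "p = v # a # ys" using q p(3) by simp
  have "leg v a (a # ys)"
  proof (rule is_leg)
    show "vpath (v # a # ys) (with_proj G)" using p e by simp
    show "deg ((a # ys) ! i) = (if i = length ys then 1 else 2)" if "i \<le> length ys" for i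
      using bspec[OF p(5), of "Suc i"] p(6) e that by auto
  qed
  then show "3 \<le> deg v \<and> (\<exists>a xs. p = v # xs \<and> leg v a xs)" using p e by auto
next
  assume "3 \<le> deg v \<and> (\<exists>a xs. p = v # xs \<and> leg v a xs)"
  then obtain a xs where *: "3 \<le> deg v" "p = v # xs" "leg v a xs" by auto
  have ne: "xs \<noteq> []" using leg_hd[OF *(3)] by simp
  have "deg (p ! i) = (if i = length xs then 1 else 2)" if "1 \<le> i" "i \<le> length xs" for i
    using leg_degrees[OF *(3), of "i - 1"] that *(2) by (auto simp: nth_Cons')
  then show "p \<in> threads G v"
    using * ne leg_vpath[OF *(3)] by (auto simp: threads_def is_thread_def out_degree_eq Suc_le_eq)
qed

lemma threadE:
  assumes "p \<in> threads G v"
  obtains "3 \<le> deg v" "(v, p ! 1) \<in> E" "set (tl p) = branch v (p ! 1)" "p = v # tl p"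
    "leg v (p ! 1) (tl p)" "distinct p" "2 \<le> length p"
proof -
  obtain a xs where *: "3 \<le> deg v" "p = v # xs" "leg v a xs" using assms thread_iff by auto
  then have "xs \<noteq> []" "hd xs = a" "(v, a) \<in> E" using leg_hd by auto
  then have "p ! 1 = a" "2 \<le> length p" using * by (cases xs; simp)+
  then show ?thesis using that * leg_set[OF *(3)] leg_vpath[OF *(3)] \<open>(v, a) \<in> E\<close>
    by (auto simp: vpath_def)
qed

lemma thread_inj:
  assumes "p \<in> threads G v" "q \<in> threads G v" "p ! 1 = q ! 1"
  shows "p = q"
  using assms leg_unique by (metis threadE)

text \<open>For different starting vertices, neither lies on the thread of the other, because inner
  vertices and ends of threads have degree at most 2. A common vertex \<open>s\<close> would then
  reach each starting vertex through the other one, forcing their distance to be 0.\<close>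

lemma threads_disjoint:
  assumes "p \<in> threads G v" "q \<in> threads G v'" "(v, p) \<noteq> (v', q)"
  shows "set (tl p) \<inter> set (tl q) = {}"
proof -
  obtain 1: "3 \<le> deg v" "(v, p ! 1) \<in> E" "set (tl p) = branch v (p ! 1)" "leg v (p ! 1) (tl p)"
    using threadE[OF assms(1)] by blast
  obtain 2: "3 \<le> deg v'" "(v', q ! 1) \<in> E" "set (tl q) = branch v' (q ! 1)" "leg v' (q ! 1) (tl q)"
    using threadE[OF assms(2)] by blast
  show ?thesis
  proof (cases "v = v'")
    case True
    then show ?thesis using 1 2 thread_inj assms branch_disjoint by metis
  next
    case False
    have VV: "v \<in> V" "v' \<in> V" using 1 2 E_in_V by auto
    have n: "v' \<notin> branch v (p ! 1)" "v \<notin> branch v' (q ! 1)"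
      using 1 2 leg_deg_le by fastforce+
    have "False" if "s \<in> branch v (p ! 1)" "s \<in> branch v' (q ! 1)" for s
      using dist_via[OF 1(2) that(1) VV(2) n(1)] dist_via[OF 2(2) that(2) VV(1) n(2)]
        dist_0[OF VV] False by simp
    then show ?thesis using 1 2 by blast
  qed
qed

section \<open>Locating threads and root vertices inside branches\<close>

lemma thin_branch_thread:
  assumes "3 \<le> deg v" "(v, a) \<in> E" "\<forall>s\<in>branch v a. deg s \<le> 2"
  obtains p where "p \<in> threads G v" "p ! 1 = a" "set (tl p) = branch v a"
proof -
  obtain xs where xs: "leg v a xs" using leg_exists assms by blast
  then have "xs \<noteq> []" "hd xs = a" using leg_hd by auto
  then have "(v # xs) ! 1 = a" by (cases xs) auto
  then show ?thesis using that[of "v # xs"] thread_iff xs assms leg_set by auto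
qed

lemma root_iff: "v \<in> root_vertices G \<longleftrightarrow> (\<exists>p q. p \<in> threads G v \<and> q \<in> threads G v \<and> p \<noteq> q)"
proof -
  have fin: "finite (threads G v)" by (rule finite_threads) (rule pair_graph)
  have "2 \<le> card (threads G v) \<longleftrightarrow> (\<exists>p q. p \<in> threads G v \<and> q \<in> threads G v \<and> p \<noteq> q)"
    using card_le_Suc0_iff_eq[OF fin] by (auto simp: not_less_eq_eq[symmetric] numeral_2_eq_2)
  then show ?thesis
    using threadE E_in_V unfolding root_vertices_def root_degree_def out_degree_eq by blast
qed

text \<open>By \<open>parent_unique\<close> at most one neighbour of \<open>z\<close> is closer to
  \<open>u\<close>, so at least two neighbours lead away from \<open>u\<close>. Their branches have
  no vertex of degree 3 or more and hence are threads.\<close>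

lemma far_root:
  assumes "z \<in> V" "3 \<le> deg z" "u \<in> V"
    "\<forall>b s. (z, b) \<in> E \<longrightarrow> d z u < d b u \<longrightarrow> s \<in> branch z b \<longrightarrow> deg s \<le> 2"
  obtains p q where "p \<in> threads G z" "q \<in> threads G z" "p \<noteq> q"
    "d z u < d (p ! 1) u" "d z u < d (q ! 1) u"
proof -
  define A where "A = {b \<in> nbrs z. d b u < d z u}"
  have "card A \<le> 1"
    using parent_unique[OF _ _ assms(3)] finite_nbrs
    by (subst One_nat_def, subst card_le_Suc0_iff_eq) (auto simp: A_def nbrs_def)
  moreover have "card (nbrs z - A) = card (nbrs z) - card A"
    using finite_nbrs by (intro card_Diff_subset) (auto simp: A_def)
  ultimately have "\<not> card (nbrs z - A) \<le> Suc 0" using assms(2) by (simp add: deg_def)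
  then obtain b b' where b: "b \<in> nbrs z - A" "b' \<in> nbrs z - A" "b \<noteq> b'"
    using card_le_Suc0_iff_eq[of "nbrs z - A"] finite_nbrs by blast
  have *: "(z, c) \<in> E \<and> d z u < d c u" if "c \<in> nbrs z - A" for c
    using that dist_E_neq[of z c u] assms(3) by (auto simp: A_def nbrs_def)
  obtain p where p: "p \<in> threads G z" "p ! 1 = b" "set (tl p) = branch z b"
    using thin_branch_thread[of z b] *[OF b(1)] assms by metis
  obtain q where q: "q \<in> threads G z" "q ! 1 = b'" "set (tl q) = branch z b'"
    using thin_branch_thread[of z b'] *[OF b(2)] assms by metis
  show ?thesis using that[OF p(1) q(1)] p q b * by auto
qed

text \<open>Among the vertices of degree at least 3 in the branch take one farthest from
  \<open>w\<close>. Beyond it all degrees are at most 2, so \<open>far_root\<close> applies, and by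
  \<open>branch_mono\<close> the threads it yields stay in the branch.\<close>

lemma branch_root:
  assumes "(w, a) \<in> E" "x \<in> branch w a" "3 \<le> deg x"
  obtains z p q where "z \<in> branch w a" "p \<in> threads G z" "q \<in> threads G z" "p \<noteq> q"
    "set (tl p) \<subseteq> branch w a" "set (tl q) \<subseteq> branch w a"
proof -
  define X where "X = {z \<in> branch w a. 3 \<le> deg z}"
  have "finite X" "X \<noteq> {}" using assms finite_branch by (auto simp: X_def)
  then obtain z where z: "z \<in> X" "\<And>y. y \<in> X \<Longrightarrow> d y w \<le> d z w"
    using ex_max_nat[of X "\<lambda>z. d z w"] by blast
  have zb: "z \<in> branch w a" "3 \<le> deg z" using z by (auto simp: X_def)
  have wV: "w \<in> V" and zV: "z \<in> V" using assms E_in_V zb branch_subset by blast+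
  have "deg s \<le> 2" if "(z, b) \<in> E" "d z w < d b w" "s \<in> branch z b" for b s
    using branch_mono[OF assms(1) zb(1) that] z(2)[of s] by (force simp: X_def)
  then have thin: "\<forall>b s. (z, b) \<in> E \<longrightarrow> d z w < d b w \<longrightarrow> s \<in> branch z b \<longrightarrow> deg s \<le> 2"
    by blast
  obtain p q where pq: "p \<in> threads G z" "q \<in> threads G z" "p \<noteq> q"
    "d z w < d (p ! 1) w" "d z w < d (q ! 1) w"
    using far_root[OF zV zb(2) wV thin] by blast
  have "set (tl r) \<subseteq> branch w a" if "r \<in> threads G z" "d z w < d (r ! 1) w" for r
    using threadE[OF that(1)] branch_mono(1)[OF assms(1) zb(1) _ that(2)] by blast
  then show ?thesis using that zb pq by blast
qed

lemma thin_tree_path: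
  assumes "\<forall>s\<in>V. deg s \<le> 2"
  shows "is_path_graph G"
proof -
  obtain u where u: "u \<in> V" using V_nonempty by auto
  show ?thesis
  proof (cases "V = {u}")
    case True
    then have "E = {}" using E_in_V E_neq by (metis equals0I singletonD prod.collapse)
    then show ?thesis using True unfolding is_path_graph_def
      by (intro exI[of _ "[u]"]) (auto simp: vpath_def)
  next
    case False
    \<comment> \<open>A vertex farthest from \<open>u\<close> is a leaf: all its neighbours are
      closer to \<open>u\<close>, and only one neighbour can be. Its single branch is then a leg
      covering the rest of the tree.\<close>
    obtain w where w: "w \<in> V" "\<And>y. y \<in> V \<Longrightarrow> d y u \<le> d w u"
      using ex_max_nat[of V "\<lambda>z. d z u"] V_nonempty pair_finite_verts by blast
    obtain y where y: "y \<in> V" "y \<noteq> u" using False u by auto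
    then have "d w u \<noteq> 0" using w(2)[OF y(1)] dist_0[of y u] u by simp
    then obtain m where "d w u = Suc m" using not0_implies_Suc by blast
    then obtain a where a: "(w, a) \<in> E" "d a u = m" using dist_step w u by metis
    have "nbrs w = {a}"
    proof -
      have lt: "d b u < d w u" if "(w, b) \<in> E" for b
        using dist_E_neq[OF that u] w(2)[OF E_in_V(2)[OF that]] by simp
      have "b = a" if "(w, b) \<in> E" for b
        by (rule parent_unique[OF that a(1) u lt[OF that] lt[OF a(1)]])
      then show ?thesis using a(1) unfolding nbrs_def by blast
    qed
    then have Vw: "V = insert w (branch w a)" using branch_cover[OF w(1)] by simp
    obtain xs where xs: "leg w a xs" using leg_exists[OF a(1)] assms branch_subset by blast
    have "V = set (w # xs)" using Vw leg_set[OF xs] by simp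
    moreover have p: "vpath (w # xs) (with_proj G)" by (rule leg_vpath[OF xs])
    moreover have "E = set (vwalk_arcs (w # xs)) \<union> (set (vwalk_arcs (w # xs)))\<inverse>"
    proof (intro set_eqI iffI)
      fix e assume "e \<in> E"
      then show "e \<in> set (vwalk_arcs (w # xs)) \<union> (set (vwalk_arcs (w # xs)))\<inverse>"
        using leg_arcs[OF xs, of "fst e" "snd e"] E_in_V Vw by (metis prod.collapse)
    next
      fix e assume "e \<in> set (vwalk_arcs (w # xs)) \<union> (set (vwalk_arcs (w # xs)))\<inverse>"
      moreover have "set (vwalk_arcs (w # xs)) \<subseteq> E"
        using p by (simp only: vpath_def vwalk_def with_proj_simps)
      ultimately show "e \<in> E" using E_sym by blast
    qed
    ultimately show ?thesis unfolding is_path_graph_def by blast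
  qed
qed

subsection \<open>Weak resolving sets\<close>

text \<open>A vertex off both threads is one step farther from each of the two neighbours of
  \<open>v\<close> than from \<open>v\<close>, so it contributes 0. Elsewhere both distances are
  within 1 of the distance to \<open>v\<close>, so they differ by at most 2.\<close>

lemma thread_pair_Delta_le:
  assumes "p \<in> threads G v" "q \<in> threads G v" "p \<noteq> q" "S \<subseteq> V"
  shows "Delta_set G S (p ! 1) (q ! 1) \<le> 2 * (card (S \<inter> set (tl p)) + card (S \<inter> set (tl q)))"
proof -
  obtain p: "(v, p ! 1) \<in> E" "set (tl p) = branch v (p ! 1)" using threadE[OF assms(1)] by blast
  obtain q: "(v, q ! 1) \<in> E" "set (tl q) = branch v (q ! 1)" using threadE[OF assms(2)] by blast
  let ?B = "set (tl p) \<union> set (tl q)"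
  have fS: "finite S" using assms pair_finite_verts finite_subset by blast
  have "Delta G s (p ! 1) (q ! 1) \<le> (if s \<in> ?B then 2 else 0)" if "s \<in> S" for s
  proof -
    have sV: "s \<in> V" using that assms by auto
    show ?thesis
    proof (cases "s \<in> ?B")
      case True
      have "d (p ! 1) s \<le> Suc (d v s)" "d v s \<le> Suc (d (p ! 1) s)"
        "d (q ! 1) s \<le> Suc (d v s)" "d v s \<le> Suc (d (q ! 1) s)"
        using dist_E_le p q E_sym sV by auto
      then show ?thesis using True by (simp add: Delta_def)
    next
      case False
      then have "d (p ! 1) s = d (q ! 1) s"
        using not_branch_dist[OF p(1) sV] not_branch_dist[OF q(1) sV] p q by simp
      then show ?thesis by (simp add: Delta_def)
    qed
  qed
  then have "Delta_set G S (p ! 1) (q ! 1) \<le> (\<Sum>s\<in>S. if s \<in> ?B then 2 else 0)"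
    unfolding Delta_set_def by (rule sum_mono)
  also have "\<dots> = 2 * card (S \<inter> ?B)"
    by (simp add: sum.inter_restrict[OF fS, symmetric] del: Un_iff)
  also have "card (S \<inter> ?B) = card (S \<inter> set (tl p)) + card (S \<inter> set (tl q))"
    unfolding Int_Un_distrib using fS threads_disjoint[OF assms(1,2)] assms(3)
    by (intro card_Un_disjoint) auto
  finally show ?thesis .
qed

lemma weak_resolving_thread_pair:
  assumes "weak_resolving G k S" "p \<in> threads G v" "q \<in> threads G v" "p \<noteq> q"
  shows "k \<le> 2 * (card (S \<inter> set (tl p)) + card (S \<inter> set (tl q)))"
proof -
  have "p ! 1 \<in> V" "q ! 1 \<in> V" using threadE assms E_in_V by metis+
  moreover have "p ! 1 \<noteq> q ! 1" using thread_inj assms by blast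
  ultimately have "k \<le> Delta_set G S (p ! 1) (q ! 1)"
    using assms(1) unfolding weak_resolving_def by blast
  also have "\<dots> \<le> 2 * (card (S \<inter> set (tl p)) + card (S \<inter> set (tl q)))"
    using assms thread_pair_Delta_le unfolding weak_resolving_def by blast
  finally show ?thesis .
qed

lemma geodesic_point:
  assumes "u \<in> V" "v \<in> V" "i \<le> d u v"
  shows "\<exists>w\<in>V. d u w = i \<and> d w v = d u v - i"
  using assms(3)
proof (induction i)
  case 0
  then show ?case using assms dist_self by (intro bexI[of _ u]) auto
next
  case (Suc i)
  then obtain w where w: "w \<in> V" "d u w = i" "d w v = d u v - i" by auto
  have "d w v = Suc (d u v - Suc i)" using w(3) Suc.prems by simp
  then obtain w' where w': "(w, w') \<in> E" "d w' v = d u v - Suc i"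
    using dist_step[OF w(1) assms(2)] by metis
  have w'V: "w' \<in> V" using w' E_in_V by blast
  have "d u w' \<le> Suc i" using dist_triangle[OF assms(1) w(1) w'V] w(2) dist_E[OF w'(1)] by simp
  moreover have "d u v \<le> d u w' + d w' v" using dist_triangle[OF assms(1) w'V assms(2)] .
  ultimately have "d u w' = Suc i" using w'(2) Suc.prems by simp
  then show ?case using w' w'V by blast
qed

text \<open>The path from \<open>y\<close> to \<open>s\<close> runs through \<open>w\<close>,
  whereas \<open>x\<close> reaches \<open>s\<close> via \<open>a\<close> and avoids the edge between
  \<open>w\<close> and \<open>a\<close> in both directions, saving 2.\<close>

lemma branch_Delta_ge:
  assumes "(w, a) \<in> E" "(w, b) \<in> E" "a \<noteq> b" "x \<in> branch w a" "y \<in> branch w b"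
    "d w x = d w y" "s \<in> branch w a"
  shows "2 \<le> Delta G s x y"
proof -
  have VV: "w \<in> V" "a \<in> V" "x \<in> V" "y \<in> V" "s \<in> V"
    using assms E_in_V branch_subset by blast+
  have "s \<notin> branch w b" using branch_disjoint[OF assms(1-3)] assms(7) by blast
  then have "d y s = d y w + d w s" using dist_via[OF assms(2,5) VV(5)] by blast
  moreover have "d x s \<le> d a x + d a s"
    using dist_triangle[OF VV(3) VV(2) VV(5)] dist_sym[OF VV(2,3)] by simp
  moreover have "d w x = Suc (d a x)" "d w s = Suc (d a s)" using branch_dist assms by auto
  ultimately show ?thesis using assms(6) dist_sym[OF VV(1,4)] by (simp add: Delta_def)
qed

lemma two_branches_thread_pair:
  assumes "\<not> is_path_graph G" "(w, a) \<in> E" "(w, b) \<in> E" "a \<noteq> b"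
  obtains v p q where "p \<in> threads G v" "q \<in> threads G v" "p \<noteq> q"
    "set (tl p) \<union> set (tl q) \<subseteq> branch w a \<union> branch w b"
proof (cases "\<exists>x\<in>branch w a \<union> branch w b. 3 \<le> deg x")
  case True
  then consider x where "x \<in> branch w a" "3 \<le> deg x" | x where "x \<in> branch w b" "3 \<le> deg x" by blast
  then show ?thesis
  proof cases
    case 1
    show ?thesis using branch_root[OF assms(2) 1] that by (metis Un_least sup.coboundedI1)
  next
    case 2
    show ?thesis using branch_root[OF assms(3) 2] that by (metis Un_least sup.coboundedI2)
  qed
next
  case False
  then have thin: "\<forall>s\<in>branch w a. deg s \<le> 2" "\<forall>s\<in>branch w b. deg s \<le> 2" by force+
  \<comment> \<open>Were the degree of \<open>w\<close> at most 2, its only neighbours would be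
    \<open>a\<close> and \<open>b\<close>; then every degree would be at most 2 and the tree would
    be a path.\<close>
  have w3: "3 \<le> deg w"
  proof (rule ccontr)
    assume w2: "\<not> 3 \<le> deg w"
    have "{a, b} \<subseteq> nbrs w" using assms by (simp add: nbrs_def)
    then have "nbrs w = {a, b}"
      using w2 assms(4) finite_nbrs by (intro card_seteq[symmetric]) (auto simp: deg_def)
    then have "V = insert w (branch w a \<union> branch w b)"
      using branch_cover[of w] E_in_V(1)[OF assms(2)] by simp
    then have "\<forall>s\<in>V. deg s \<le> 2" using thin w2 by auto
    then show False using thin_tree_path assms(1) by blast
  qed
  obtain p where p: "p \<in> threads G w" "p ! 1 = a" "set (tl p) = branch w a"
    using thin_branch_thread[OF w3 assms(2) thin(1)] .
  obtain q where q: "q \<in> threads G w" "q ! 1 = b" "set (tl q) = branch w b"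
    using thin_branch_thread[OF w3 assms(3) thin(2)] .
  show ?thesis using that[OF p(1) q(1)] p q assms(4) by auto
qed

lemma weak_resolvingI:
  assumes "\<not> is_path_graph G" "S \<subseteq> V" "k \<le> card S"
    "\<And>v p q. p \<in> threads G v \<Longrightarrow> q \<in> threads G v \<Longrightarrow> p \<noteq> q \<Longrightarrow>
      k \<le> 2 * card (S \<inter> (set (tl p) \<union> set (tl q)))"
  shows "weak_resolving G k S"
  unfolding weak_resolving_def
proof (intro conjI ballI impI)
  fix x y assume xy: "x \<in> V" "y \<in> V" "x \<noteq> y"
  have fS: "finite S" using assms pair_finite_verts finite_subset by blast
  show "k \<le> Delta_set G S x y"
  proof (cases "even (d x y)")
    case False
    have "1 \<le> Delta G s x y" if "s \<in> S" for s
    proof -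
      have "odd (d x s + d y s)" using parity xy that assms(2) False by blast
      then have "d x s \<noteq> d y s" by auto
      then show ?thesis by (simp add: Delta_def)
    qed
    then have "(\<Sum>s\<in>S. 1) \<le> Delta_set G S x y" unfolding Delta_set_def by (rule sum_mono)
    then show ?thesis using assms(3) by simp
  next
    case True
    then obtain r where r: "d x y = 2 * r" by blast
    have "d x y \<noteq> 0" using xy dist_0 by simp
    then obtain m where m: "r = Suc m" using r by (cases r) auto
    obtain w where w: "w \<in> V" "d x w = r" "d w y = r" using geodesic_point[OF xy(1,2), of r] r by auto
    have wx: "d w x = r" using w dist_sym xy by simp
    obtain a where a: "(w, a) \<in> E" "d a x = m" using dist_step[OF w(1) xy(1)] wx m by metis
    obtain b where b: "(w, b) \<in> E" "d b y = m" using dist_step[OF w(1) xy(2)] w(3) m by metis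
    have xa: "x \<in> branch w a" and yb: "y \<in> branch w b"
      using a b wx w m xy by (auto simp: branch_def)
    \<comment> \<open>A common first step from the midpoint would give a walk from \<open>x\<close>
      to \<open>y\<close> of length \<open>2 * m\<close>, shorter than their distance
      \<open>2 * r\<close>.\<close>
    have ab: "a \<noteq> b"
    proof
      assume "a = b"
      then have "d x y \<le> m + m"
        using dist_triangle[of x a y] dist_sym[of x a] a b xy E_in_V[OF a(1)] by simp
      then show False using r m by simp
    qed
    let ?B = "branch w a \<union> branch w b"
    have "(if s \<in> ?B then 2 else 0) \<le> Delta G s x y" for s
    proof -
      have "Delta G s x y = Delta G s y x" by (simp add: Delta_def)
      then show ?thesis
        using branch_Delta_ge[OF a(1) b(1) ab xa yb] branch_Delta_ge[OF b(1) a(1) ab[symmetric] yb xa]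
          wx w(3) by fastforce
    qed
    then have "(\<Sum>s\<in>S. if s \<in> ?B then 2 else 0) \<le> Delta_set G S x y"
      unfolding Delta_set_def by (intro sum_mono) auto
    then have *: "2 * card (S \<inter> ?B) \<le> Delta_set G S x y"
      by (simp add: sum.inter_restrict[OF fS, symmetric] del: Un_iff)
    obtain v p q where pq: "p \<in> threads G v" "q \<in> threads G v" "p \<noteq> q"
      "set (tl p) \<union> set (tl q) \<subseteq> ?B"
      using two_branches_thread_pair[OF assms(1) a(1) b(1) ab] .
    have "card (S \<inter> (set (tl p) \<union> set (tl q))) \<le> card (S \<inter> ?B)"
      using fS pq(4) by (intro card_mono) auto
    then show ?thesis using assms(4)[OF pq(1-3)] * by simp
  qed
qed (use assms in auto)

text \<open>Enlarging a set only increases the sums, so \<open>V\<close> is the best candidate. The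
  value 1 is attained by \<open>V\<close>, and the pair \<open>x\<close>, \<open>y\<close> bounds
  all attainable values, so the \<open>GREATEST\<close> in \<open>kappa\<close> is attained.\<close>

lemma kappa_weak_resolving:
  assumes "x \<in> V" "y \<in> V" "x \<noteq> y" "k \<le> kappa G"
  shows "weak_resolving G k V"
proof -
  let ?Q = "\<lambda>j. 1 \<le> j \<and> (\<exists>S. weak_resolving G j S)"
  have mono: "Delta_set G S x y \<le> Delta_set G V x y" if "S \<subseteq> V" for S x y
    unfolding Delta_set_def using that pair_finite_verts by (intro sum_mono2) auto
  have "1 \<le> Delta_set G V x y" if "x \<in> V" "y \<in> V" "x \<noteq> y" for x y
  proof -
    have "1 \<le> Delta G x x y" using dist_0[of y x] that dist_self[of x] by (auto simp: Delta_def)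
    also have "\<dots> \<le> Delta_set G V x y"
      unfolding Delta_set_def using that pair_finite_verts by (intro member_le_sum) auto
    finally show ?thesis .
  qed
  then have "?Q 1" by (auto simp: weak_resolving_def)
  moreover have "j \<le> Delta_set G V x y" if "?Q j" for j
    using that mono assms(1-3) unfolding weak_resolving_def by (meson le_trans)
  ultimately have "?Q (kappa G)" unfolding kappa_def by (rule GreatestI_nat) blast
  then obtain S where "weak_resolving G (kappa G) S" by blast
  then show ?thesis using mono assms(4) unfolding weak_resolving_def by (meson le_trans order_refl)
qed

subsection \<open>Root vertices\<close>

text \<open>Start from any \<open>z\<close> of degree at least 3. Either a branch at
  \<open>z\<close> contains another such vertex, and hence a root, or all branches at
  \<open>z\<close> are threads and \<open>z\<close> itself is a root.\<close>

lemma root_exists: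
  assumes "\<not> is_path_graph G"
  shows "root_vertices G \<noteq> {}"
proof -
  obtain z where z: "z \<in> V" "3 \<le> deg z" using thin_tree_path assms by force
  show ?thesis
  proof (cases "\<exists>b x. (z, b) \<in> E \<and> x \<in> branch z b \<and> 3 \<le> deg x")
    case True
    then show ?thesis using branch_root root_iff by (metis empty_iff)
  next
    case False
    then have "\<forall>b s. (z, b) \<in> E \<longrightarrow> d z z < d b z \<longrightarrow> s \<in> branch z b \<longrightarrow> deg s \<le> 2" by force
    then show ?thesis using far_root[OF z z(1)] root_iff by (metis empty_iff)
  qed
qed

text \<open>A vertex of degree at least 3 in a branch at \<open>v\<close> would produce a second
  root, so each branch at \<open>v\<close> is a thread and there are at least as many threads as
  neighbours.\<close>

lemma single_root_degree:
  assumes "root_vertices G = {v}"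
  shows "3 \<le> root_degree G v"
proof -
  have thin: "deg x \<le> 2" if "(v, a) \<in> E" "x \<in> branch v a" for a x
  proof (rule ccontr)
    assume "\<not> deg x \<le> 2"
    then have "3 \<le> deg x" by simp
    with that obtain z p q where "z \<in> branch v a" "p \<in> threads G z" "q \<in> threads G z" "p \<noteq> q"
      by (rule branch_root)
    then have "z \<in> root_vertices G" using root_iff[of z] by blast
    then show False using assms \<open>z \<in> branch v a\<close> not_in_branch by auto
  qed
  have "v \<in> root_vertices G" using assms by simp
  then have v3: "3 \<le> deg v" by (simp add: root_vertices_def out_degree_eq)
  have "nbrs v \<subseteq> (\<lambda>p. p ! 1) ` threads G v"
  proof
    fix a assume "a \<in> nbrs v"
    then have "(v, a) \<in> E" by (simp add: nbrs_def)
    then obtain p where "p \<in> threads G v" "p ! 1 = a" using thin_branch_thread[OF v3] thin by blast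
    then show "a \<in> (\<lambda>p. p ! 1) ` threads G v" by blast
  qed
  then have "card (nbrs v) \<le> card (threads G v)"
    using finite_threads[OF pair_graph] by (rule surj_card_le[rotated])
  then show ?thesis using v3 by (simp add: deg_def root_degree_def)
qed

lemma roots_cases:
  assumes "\<not> is_path_graph G" "\<not> (\<exists>l1 l2 l3. is_S3 G l1 l2 l3)"
  obtains v v' where "v \<in> root_vertices G" "v' \<in> root_vertices G" "v \<noteq> v'"
  | v where "v \<in> root_vertices G" "4 \<le> root_degree G v"
proof -
  obtain v where v: "v \<in> root_vertices G" using root_exists assms by blast
  show ?thesis
  proof (cases "root_vertices G = {v}")
    case True
    have "root_degree G v \<noteq> 3"
    proof
      assume 3: "root_degree G v = 3"
      let ?M = "image_mset vwalk_length (mset_set (threads G v))"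
      have "size ?M = 3" using 3 by (simp add: root_degree_def)
      then obtain l1 l2 l3 where "?M = {#l1, l2, l3#}"
        using size_mset_3 by blast
      then show False using assms(2) is_tree True 3 unfolding is_S3_def by blast
    qed
    then have "4 \<le> root_degree G v" using single_root_degree[OF True] by simp
    then show ?thesis using that(2) v by blast
  next
    case False
    then show ?thesis using that(1) v by blast
  qed
qed

end

section \<open>Labelled threads and the sizes of their parts\<close>

locale labelled_tree = simple_tree G for G :: "'a pair_pre_digraph" +
  fixes P :: "'a \<Rightarrow> nat \<Rightarrow> 'a list"
  assumes labelling: "thread_labelling G P"
begin

abbreviation R where "R \<equiv> root_vertices G"
abbreviation L where "L \<equiv> root_degree G"
definition len where "len v j = length (P v j) - 1"

lemma finite_R: "finite R"
  using pair_finite_verts by (simp add: root_vertices_def)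

lemma L_ge_2: "v \<in> R \<Longrightarrow> 2 \<le> L v"
  by (simp add: root_vertices_def)

lemma P_bij: "v \<in> R \<Longrightarrow> bij_betw (P v) {1..L v} (threads G v)"
  using labelling by (simp add: thread_labelling_def)

lemma P_thread: "v \<in> R \<Longrightarrow> j \<in> {1..L v} \<Longrightarrow> P v j \<in> threads G v"
  using P_bij bij_betwE by blast

lemma P_inj: "v \<in> R \<Longrightarrow> i \<in> {1..L v} \<Longrightarrow> j \<in> {1..L v} \<Longrightarrow> i \<noteq> j \<Longrightarrow> P v i \<noteq> P v j"
  using P_bij by (metis bij_betw_def inj_on_def)

lemma P_surj:
  assumes "v \<in> R" "p \<in> threads G v"
  obtains j where "j \<in> {1..L v}" "p = P v j"
  using P_bij[OF assms(1)] assms(2) by (metis bij_betw_def imageE)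

lemma len_mono: "v \<in> R \<Longrightarrow> j \<in> {1..L v} \<Longrightarrow> len v 1 \<le> len v j"
  using labelling by (auto simp: thread_labelling_def len_def dest!: bspec mono_onD[where r = 1])

lemma P_tails_disjoint:
  assumes "v \<in> R" "i \<in> {1..L v}" "v' \<in> R" "j \<in> {1..L v'}" "(v, i) \<noteq> (v', j)"
  shows "set (tl (P v i)) \<inter> set (tl (P v' j)) = {}"
  using assms P_thread P_inj by (intro threads_disjoint) auto

text \<open>Threads with different labels have disjoint tails, so sizes add up. This serves both the
  size of \<open>S_tree\<close> and the lower bound for arbitrary sets.\<close>

lemma card_tails_union:
  assumes "\<And>v j. v \<in> R \<Longrightarrow> j \<in> {1..L v} \<Longrightarrow> X v j \<subseteq> set (tl (P v j))"
  shows "card (\<Union>v\<in>R. \<Union>j\<in>{1..L v}. X v j) = (\<Sum>v\<in>R. \<Sum>j\<in>{1..L v}. card (X v j))"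
proof -
  let ?I = "Sigma R (\<lambda>v. {1..L v})"
  have "(\<Union>v\<in>R. \<Union>j\<in>{1..L v}. X v j) = (\<Union>(v, j)\<in>?I. X v j)" by auto
  also have "card \<dots> = (\<Sum>(v, j)\<in>?I. card (X v j))"
  proof (subst card_UN_disjoint)
    show "finite ?I" using finite_R by auto
    show "\<forall>x\<in>?I. finite (case x of (v, j) \<Rightarrow> X v j)"
      using assms finite_subset by (fastforce simp: split_beta)
    show "\<forall>x\<in>?I. \<forall>y\<in>?I. x \<noteq> y \<longrightarrow> (case x of (v, j) \<Rightarrow> X v j) \<inter> (case y of (v, j) \<Rightarrow> X v j) = {}"
    proof (intro ballI impI)
      fix x y assume "x \<in> ?I" "y \<in> ?I" "x \<noteq> y"
      then obtain v i v' j where e: "x = (v, i)" "y = (v', j)" "v \<in> R" "v' \<in> R" "i \<in> {1..L v}"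
        "j \<in> {1..L v'}" "(v, i) \<noteq> (v', j)" by (cases x; cases y) blast
      have "set (tl (P v i)) \<inter> set (tl (P v' j)) = {}" using P_tails_disjoint e by blast
      then show "(case x of (v, j) \<Rightarrow> X v j) \<inter> (case y of (v, j) \<Rightarrow> X v j) = {}"
        using assms[of v i] assms[of v' j] e by auto
    qed
  qed (simp add: split_beta)
  also have "\<dots> = (\<Sum>v\<in>R. \<Sum>j\<in>{1..L v}. card (X v j))"
    using finite_R by (subst sum.Sigma) auto
  finally show ?thesis .
qed

lemma card_Int_tl: "card (S \<inter> set (tl p)) \<le> length p - 1"
  by (metis card_length card_mono finite_set inf_le2 le_trans length_tl)

text \<open>Indices start at 1 because index 0 holds the root vertex itself.\<close>

definition seg :: "'a list \<Rightarrow> nat \<Rightarrow> 'a set" where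
  "seg p m = {p ! i | i. 1 \<le> i \<and> i \<le> m}"

lemma seg_eq_image: "seg p m = (!) p ` {1..m}"
  by (auto simp: seg_def)

lemma seg_subset:
  assumes "m \<le> length p - 1"
  shows "seg p m \<subseteq> set (tl p)"
proof
  fix s assume "s \<in> seg p m"
  then obtain i where "s = p ! i" "1 \<le> i" "i \<le> m" by (auto simp: seg_def)
  then have "s = tl p ! (i - 1)" "i - 1 < length (tl p)" using assms by (auto simp: nth_tl)
  then show "s \<in> set (tl p)" by simp
qed

lemma card_seg: "distinct p \<Longrightarrow> m \<le> length p - 1 \<Longrightarrow> card (seg p m) = m"
  unfolding seg_eq_image
  by (subst card_image) (auto simp: inj_on_def nth_eq_iff_index_eq)

text \<open>\<open>cnt k v j\<close> is the number of vertices of the \<open>j\<close>-th thread at \<open>v\<close> that belong to \<open>S\<^sub>k(v)\<close>.\<close>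

definition cnt :: "nat \<Rightarrow> 'a \<Rightarrow> nat \<Rightarrow> nat" where
  "cnt k v j =
    (if (k + 3) div 4 \<le> len v 1
     then if j = 1 \<and> k mod 4 \<in> {1, 2} then (k + 3) div 4 - 1 else (k + 3) div 4
     else if j = 1 then len v 1 else (k + 1) div 2 - len v 1)"

text \<open>All threads other than the first have the same count, for which \<open>cnt k v 2\<close>
  stands.\<close>

lemma sum_cnt:
  assumes "L v = Suc M"
  shows "(\<Sum>j\<in>{1..L v}. cnt k v j) = cnt k v 1 + M * cnt k v 2"
proof -
  have "{1..L v} = insert 1 {2..L v}" using assms by auto
  then have "(\<Sum>j\<in>{1..L v}. cnt k v j) = cnt k v 1 + (\<Sum>j\<in>{2..L v}. cnt k v j)" by simp
  also have "(\<Sum>j\<in>{2..L v}. cnt k v j) = (\<Sum>j\<in>{2..L v}. cnt k v 2)"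
    by (intro sum.cong) (auto simp: cnt_def)
  finally show ?thesis using assms by simp
qed

lemma f_val_eq_sum:
  assumes "v \<in> R"
  shows "f_val G P k v = (\<Sum>j\<in>{1..L v}. cnt k v j)"
proof -
  obtain M where M: "L v = Suc M" using L_ge_2[OF assms] by (cases "L v") auto
  \<comment> \<open>Guards the truncated subtraction of 1 in \<open>f_val\<close> and
    \<open>cnt\<close>.\<close>
  have "(k + 3) div 4 \<ge> 1" if "k mod 4 \<in> {1, 2}" using that by (cases "k = 0") auto
  then show ?thesis
    unfolding sum_cnt[OF M] f_val_def Let_def
    using ceiling_div[of 4 k] ceiling_div[of 2 k] M
    by (auto simp: cnt_def len_def algebra_simps)
qed

lemma cnt_pair:
  assumes "i \<noteq> j"
  shows "k \<le> 2 * (cnt k v i + cnt k v j)"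
proof -
  define c2 c4 where "c2 = (k + 1) div 2" and "c4 = (k + 3) div 4"
  have c: "k \<le> 2 * c2" "2 * c4 \<le> c2 + 1" by (auto simp: c2_def c4_def)
  have c': "k mod 4 \<in> {1, 2} \<Longrightarrow> c2 + 1 = 2 * c4" "k mod 4 \<notin> {1, 2} \<Longrightarrow> c2 = 2 * c4"
    unfolding c2_def c4_def by (rule half_quarter_odd half_quarter_even, assumption)+
  show ?thesis
  proof (cases "c4 \<le> len v 1")
    case True
    have "c2 \<le> cnt k v i + cnt k v j"
      using True c' assms unfolding cnt_def c4_def[symmetric]
      by (cases "k mod 4 \<in> {1, 2}") (simp_all, linarith+)
    then show ?thesis by (intro order_trans[OF c(1)]) simp
  next
    case False
    \<comment> \<open>Needed when neither thread is the first: both then carry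
      \<open>c2 - len v 1\<close> vertices, and twice that is at least \<open>c2\<close>.\<close>
    then have "2 * len v 1 \<le> c2" using c by simp
    then have "c2 \<le> cnt k v i + cnt k v j"
      using False assms unfolding cnt_def c4_def[symmetric] c2_def[symmetric] by (simp, arith)
    then show ?thesis by (intro order_trans[OF c(1)]) simp
  qed
qed

section \<open>The set \<open>S_tree\<close> for an admissible k\<close>

context
  fixes k :: nat
  assumes k_ge_1: "1 \<le> k" and k_le_kappa: "k \<le> kappa G"
begin

text \<open>The threads are long enough for the prescribed segments. Since \<open>k\<close> is at
  most \<open>kappa G\<close>, the whole vertex set resolves the first and the \<open>j\<close>-th
  thread, which gives \<open>k \<le> 2 * (len v 1 + len v j)\<close>.\<close>

lemma cnt_le_len:
  assumes "v \<in> R" "j \<in> {1..L v}"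
  shows "cnt k v j \<le> len v j"
proof -
  have "(k + 1) div 2 - len v 1 \<le> len v j" if "j \<noteq> 1"
  proof -
    have 1: "1 \<in> {1..L v}" using assms by auto
    note th = P_thread[OF assms(1) 1] P_thread[OF assms]
    have ne: "P v 1 \<noteq> P v j" using P_inj[OF assms(1) 1 assms(2)] that by simp
    have "P v 1 ! 1 \<noteq> P v j ! 1" using thread_inj[OF th] ne by blast
    moreover have "P v 1 ! 1 \<in> V" "P v j ! 1 \<in> V" using threadE th E_in_V by metis+
    ultimately have "weak_resolving G k V" using kappa_weak_resolving k_le_kappa by blast
    from weak_resolving_thread_pair[OF this th ne]
    have "k \<le> 2 * (card (V \<inter> set (tl (P v 1))) + card (V \<inter> set (tl (P v j))))" .
    also have "\<dots> \<le> 2 * (len v 1 + len v j)"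
      unfolding len_def by (intro mult_le_mono2 add_mono card_Int_tl)
    finally have "k \<le> 2 * (len v 1 + len v j)" .
    then show ?thesis by presburger
  qed
  then show ?thesis using len_mono[OF assms] by (auto simp: cnt_def)
qed

lemma S_root_eq:
  assumes "v \<in> R"
  shows "S_root G P k v = (\<Union>j\<in>{1..L v}. seg (P v j) (cnt k v j))"
proof -
  let ?c = "(k + 3) div 4"
  have c4: "nat \<lceil>real k / 4\<rceil> = ?c" and c2: "nat \<lceil>real k / 2\<rceil> = (k + 1) div 2"
    using ceiling_div[of 4 k] ceiling_div[of 2 k] by simp_all
  have S1: "S1_set G P k v = (\<Union>j\<in>{1..L v}. seg (P v j) ?c)"
    unfolding S1_set_def c4 seg_def by fastforce
  have L2: "2 \<le> L v" by (rule L_ge_2[OF assms])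
  have 1: "1 \<in> {1..L v}" using L2 by simp
  consider (a) "?c \<le> len v 1" "k mod 4 \<in> {1, 2}" | (b) "?c \<le> len v 1" "k mod 4 \<notin> {1, 2}"
    | (c) "\<not> ?c \<le> len v 1" by blast
  then show ?thesis
  proof cases
    case a
    \<comment> \<open>The deleted vertex is thus a proper vertex of the first thread and not the
      root at index 0.\<close>
    have c1: "1 \<le> ?c" using k_ge_1 by simp
    obtain p: "distinct (P v 1)" using threadE[OF P_thread[OF assms 1]] by blast
    have "seg (P v 1) ?c - {P v 1 ! ?c} = seg (P v 1) (?c - 1)"
    proof -
      have "{1..?c} = insert ?c {1..?c - 1}" using c1 by auto
      then have "seg (P v 1) ?c = insert (P v 1 ! ?c) (seg (P v 1) (?c - 1))"
        by (simp add: seg_eq_image)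
      moreover have "P v 1 ! ?c \<notin> seg (P v 1) (?c - 1)"
        using p a(1) c1 by (auto simp: seg_def len_def nth_eq_iff_index_eq)
      ultimately show ?thesis by simp
    qed
    \<comment> \<open>The deletion does not affect the other threads, whose tails are disjoint from
      the first.\<close>
    moreover have "seg (P v j) ?c - {P v 1 ! ?c} = seg (P v j) ?c" if "j \<in> {1..L v}" "j \<noteq> 1" for j
    proof -
      have "P v 1 ! ?c \<in> seg (P v 1) ?c" using c1 by (auto simp: seg_def)
      then have "P v 1 ! ?c \<in> set (tl (P v 1))" using seg_subset a(1) by (auto simp: len_def)
      moreover have "seg (P v j) ?c \<subseteq> set (tl (P v j))"
        using len_mono[OF assms that(1)] a(1) by (intro seg_subset) (simp add: len_def)
      moreover have "set (tl (P v 1)) \<inter> set (tl (P v j)) = {}"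
        using P_tails_disjoint[OF assms 1 assms that(1)] that(2) by simp
      ultimately show ?thesis by blast
    qed
    ultimately have "seg (P v j) ?c - {P v 1 ! ?c} = seg (P v j) (cnt k v j)" if "j \<in> {1..L v}" for j
      using that a by (cases "j = 1") (simp_all add: cnt_def)
    moreover have "S_root G P k v = (\<Union>j\<in>{1..L v}. seg (P v j) ?c - {P v 1 ! ?c})"
      using a S1 by (auto simp: S_root_def Let_def c4 len_def)
    ultimately show ?thesis by simp
  next
    case b
    then show ?thesis using S1 by (auto simp: S_root_def Let_def c4 len_def cnt_def)
  next
    case c
    have "{1..L v} = insert 1 {2..L v}" using L2 by auto
    moreover have "S2_set G P k v = seg (P v 1) (len v 1) \<union> (\<Union>j\<in>{2..L v}. seg (P v j) ((k + 1) div 2 - len v 1))"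
      unfolding S2_set_def c2 seg_def len_def vwalk_length_simp by fastforce
    moreover have "S_root G P k v = S2_set G P k v"
      using c by (simp add: S_root_def c4 len_def)
    ultimately show ?thesis using c by (simp add: cnt_def)
  qed
qed

lemma seg_tail: "v \<in> R \<Longrightarrow> j \<in> {1..L v} \<Longrightarrow> seg (P v j) (cnt k v j) \<subseteq> set (tl (P v j))"
  using cnt_le_len by (intro seg_subset) (simp add: len_def)

lemma card_seg_cnt:
  assumes "v \<in> R" "j \<in> {1..L v}"
  shows "card (seg (P v j) (cnt k v j)) = cnt k v j"
proof -
  have "distinct (P v j)" using threadE[OF P_thread[OF assms]] by blast
  then show ?thesis using cnt_le_len[OF assms] by (intro card_seg) (simp_all add: len_def)
qed

lemma S_tree_eq: "S_tree G P k = (\<Union>v\<in>R. \<Union>j\<in>{1..L v}. seg (P v j) (cnt k v j))"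
  using S_root_eq by (simp add: S_tree_def)

lemma card_S_tree: "card (S_tree G P k) = (\<Sum>v\<in>R. f_val G P k v)"
proof -
  have "card (S_tree G P k) = (\<Sum>v\<in>R. \<Sum>j\<in>{1..L v}. card (seg (P v j) (cnt k v j)))"
    unfolding S_tree_eq by (rule card_tails_union) (rule seg_tail)
  also have "\<dots> = (\<Sum>v\<in>R. f_val G P k v)"
    using card_seg_cnt f_val_eq_sum by (intro sum.cong) auto
  finally show ?thesis .
qed

lemma S_tree_subset: "S_tree G P k \<subseteq> V"
proof -
  have "set (tl (P v j)) \<subseteq> V" if "v \<in> R" "j \<in> {1..L v}" for v j
    using threadE[OF P_thread[OF that]] branch_subset by metis
  then show ?thesis unfolding S_tree_eq using seg_tail by blast
qed

lemma S_tree_thread_pair: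
  assumes "p \<in> threads G v" "q \<in> threads G v" "p \<noteq> q"
  shows "k \<le> 2 * card (S_tree G P k \<inter> (set (tl p) \<union> set (tl q)))"
proof -
  have v: "v \<in> R" using root_iff assms by blast
  obtain i where i: "i \<in> {1..L v}" "p = P v i" using P_surj v assms(1) .
  obtain j where j: "j \<in> {1..L v}" "q = P v j" using P_surj v assms(2) .
  have ij: "i \<noteq> j" using i j assms(3) by blast
  let ?A = "seg (P v i) (cnt k v i)" and ?B = "seg (P v j) (cnt k v j)"
  have sub: "?A \<subseteq> set (tl p)" "?B \<subseteq> set (tl q)" using seg_tail[OF v] i j by auto
  have "set (tl p) \<inter> set (tl q) = {}" using threads_disjoint[OF assms(1,2)] assms(3) by simp
  then have "card (?A \<union> ?B) = card ?A + card ?B"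
    using sub finite_subset by (intro card_Un_disjoint) blast+
  then have c: "card (?A \<union> ?B) = cnt k v i + cnt k v j"
    using card_seg_cnt[OF v i(1)] card_seg_cnt[OF v j(1)] by simp
  have "?A \<union> ?B \<subseteq> S_tree G P k \<inter> (set (tl p) \<union> set (tl q))"
    using sub v i(1) j(1) unfolding S_tree_eq by blast
  then have "card (?A \<union> ?B) \<le> card (S_tree G P k \<inter> (set (tl p) \<union> set (tl q)))"
    by (intro card_mono) auto
  then show ?thesis using c cnt_pair[OF ij, of k v] by simp
qed

lemma f_val_ge:
  assumes "v \<in> R"
  shows "k \<le> 2 * f_val G P k v"
proof -
  have "(\<Sum>j\<in>{1, 2}. cnt k v j) \<le> f_val G P k v"
    unfolding f_val_eq_sum[OF assms] using L_ge_2[OF assms] by (intro sum_mono2) auto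
  then show ?thesis using cnt_pair[of 1 2 k v] by simp
qed

text \<open>Two roots, or four threads at one root, provide two disjoint pairs of threads, each
  holding at least k/2 vertices of the set.\<close>

lemma k_le_card_S_tree:
  assumes "\<not> is_path_graph G" "\<not> (\<exists>l1 l2 l3. is_S3 G l1 l2 l3)"
  shows "k \<le> card (S_tree G P k)"
  using assms
proof (cases rule: roots_cases)
  case (1 v v')
  have "(\<Sum>u\<in>{v, v'}. f_val G P k u) \<le> card (S_tree G P k)"
    unfolding card_S_tree using 1 finite_R by (intro sum_mono2) auto
  then show ?thesis using f_val_ge[OF 1(1)] f_val_ge[OF 1(2)] 1(3) by simp
next
  case (2 v)
  have "(\<Sum>j\<in>{1, 2, 3, 4}. cnt k v j) \<le> f_val G P k v"
    unfolding f_val_eq_sum[OF 2(1)] using 2(2) by (intro sum_mono2) auto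
  moreover have "f_val G P k v \<le> card (S_tree G P k)"
    unfolding card_S_tree using 2(1) finite_R by (intro member_le_sum) auto
  ultimately show ?thesis using cnt_pair[of 1 2 k v] cnt_pair[of 3 4 k v] by simp
qed

lemma S_tree_weak_resolving:
  assumes "\<not> is_path_graph G" "\<not> (\<exists>l1 l2 l3. is_S3 G l1 l2 l3)"
  shows "weak_resolving G k (S_tree G P k)"
  using assms(1) S_tree_subset k_le_card_S_tree[OF assms] S_tree_thread_pair by (rule weak_resolvingI)

section \<open>Lower bound for arbitrary weak resolving sets\<close>

lemma f_val_le:
  assumes "v \<in> R" "weak_resolving G k S"
  shows "f_val G P k v \<le> (\<Sum>j\<in>{1..L v}. card (S \<inter> set (tl (P v j))))"
proof -
  define a where "a j = card (S \<inter> set (tl (P v j)))" for j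
  obtain M where M: "L v = Suc (Suc M)" using L_ge_2[OF assms(1)] by (metis add_2_eq_Suc le_Suc_ex)
  have pair: "(k + 1) div 2 \<le> a i + a j" if "i \<in> {1..L v}" "j \<in> {1..L v}" "i \<noteq> j" for i j
  proof -
    have "k \<le> 2 * (a i + a j)"
      unfolding a_def using assms that P_thread P_inj by (intro weak_resolving_thread_pair) auto
    then show ?thesis by presburger
  qed
  \<comment> \<open>The thread with the fewest vertices of \<open>S\<close>. It need not be the
    first one, but its count is at most that of the first and hence at most
    \<open>len v 1\<close>.\<close>
  obtain m where m: "m \<in> {1..L v}" "\<forall>j\<in>{1..L v}. a m \<le> a j"
    using arg_min_if_finite[of "{1..L v}" a] M by (metis atLeastAtMost_iff finite_atLeastAtMost not_less empty_iff le_add1 plus_1_eq_Suc order_refl)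
  have "card (S \<inter> set (tl (P v 1))) \<le> len v 1"
    unfolding len_def by (rule card_Int_tl)
  then have am: "a m \<le> len v 1" using m(2) M unfolding a_def by (metis atLeastAtMost_iff le_add1 le_trans order_refl plus_1_eq_Suc)
  \<comment> \<open>Every other thread carries at least \<open>e\<close> vertices: at least
    \<open>a m\<close> by minimality, and at least the rest of k/2 rounded up by the pair constraint
    with \<open>m\<close>.\<close>
  define e where "e = max (a m) ((k + 1) div 2 - a m)"
  have "(\<Sum>j\<in>{1..L v} - {m}. e) \<le> (\<Sum>j\<in>{1..L v} - {m}. a j)"
    using pair[OF m(1)] m(2) by (intro sum_mono) (fastforce simp: e_def)
  moreover have "(\<Sum>j\<in>{1..L v}. a j) = a m + (\<Sum>j\<in>{1..L v} - {m}. a j)"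
    using m(1) by (intro sum.remove) auto
  ultimately have sum_ge: "a m + e + M * e \<le> (\<Sum>j\<in>{1..L v}. a j)"
    using m(1) M by simp
  have f: "f_val G P k v = cnt k v 1 + cnt k v 2 + M * cnt k v 2"
    unfolding f_val_eq_sum[OF assms(1)] sum_cnt[OF M] by simp
  have e: "a m \<le> e" "(k + 1) div 2 \<le> a m + e" by (auto simp: e_def)
  \<comment> \<open>Both totals consist of one pair and \<open>M\<close> further equal terms, so
    comparing the pair and a single term suffices. For a long first thread,
    \<open>a m \<le> e\<close> makes \<open>e\<close> at least half the pair bound; for a short one,
    \<open>a m \<le> len v 1\<close> forces the others to compensate.\<close>
  have "cnt k v 1 + cnt k v 2 \<le> a m + e \<and> cnt k v 2 \<le> e"
  proof (cases "(k + 3) div 4 \<le> len v 1")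
    case True
    show ?thesis
    proof (cases "k mod 4 \<in> {1, 2}")
      case mod: True
      then have "cnt k v 1 = (k + 3) div 4 - 1" "cnt k v 2 = (k + 3) div 4"
        using True by (simp_all add: cnt_def)
      then show ?thesis using e half_quarter_odd[OF mod] by linarith
    next
      case mod: False
      then have "cnt k v 1 = (k + 3) div 4" "cnt k v 2 = (k + 3) div 4"
        using True by (simp_all add: cnt_def)
      then show ?thesis using e half_quarter_even[OF mod] by linarith
    qed
  next
    case False
    then have "cnt k v 1 = len v 1" "cnt k v 2 = (k + 1) div 2 - len v 1"
      by (simp_all add: cnt_def)
    moreover have "2 * len v 1 \<le> (k + 1) div 2" using False by presburger
    ultimately show ?thesis using e am by linarith
  qed
  then have "f_val G P k v \<le> a m + e + M * e"
    unfolding f by (metis add_le_mono mult_le_mono2)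
  then show ?thesis using sum_ge by (simp add: a_def)
qed

lemma weak_resolving_card_ge:
  assumes "weak_resolving G k S"
  shows "(\<Sum>v\<in>R. f_val G P k v) \<le> card S"
proof -
  have "(\<Sum>v\<in>R. f_val G P k v) \<le> (\<Sum>v\<in>R. \<Sum>j\<in>{1..L v}. card (S \<inter> set (tl (P v j))))"
    using f_val_le assms by (intro sum_mono) auto
  also have "\<dots> = card (\<Union>v\<in>R. \<Union>j\<in>{1..L v}. S \<inter> set (tl (P v j)))"
    by (rule card_tails_union[symmetric]) auto
  also have "\<dots> \<le> card S"
    using assms finite_subset[OF _ pair_finite_verts]
    by (intro card_mono) (auto simp: weak_resolving_def)
  finally show ?thesis .
qed

end

end

theorem theorem4p1:
  fixes T :: "'a pair_pre_digraph" and n k :: nat and P :: "'a \<Rightarrow> nat \<Rightarrow> 'a list"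
  assumes "is_tree T" and "card (pverts T) = n"
    and "\<not> is_path_graph T"
    and "\<not> (\<exists>l1 l2 l3. is_S3 T l1 l2 l3)"
    and "thread_labelling T P"
    and "1 \<le> k" and "k \<le> kappa T"
  shows "wdim k T = (\<Sum>v\<in>root_vertices T. f_val T P k v) \<and>
    is_arg_min card (weak_resolving T k) (S_tree T P k)"
proof -
  interpret pair_graph T using assms(1) by (simp add: is_tree_def)
  interpret labelled_tree T P using assms(1,5) by unfold_locales
  note S = S_tree_weak_resolving[OF assms(6,7,3,4)] and
    card = card_S_tree[OF assms(6,7)] and lower = weak_resolving_card_ge[OF assms(6,7)]
  have "wdim k T = (\<Sum>v\<in>root_vertices T. f_val T P k v)"
    unfolding wdim_def using S card lower by (intro Least_equality) auto
  moreover have "is_arg_min card (weak_resolving T k) (S_tree T P k)"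
    unfolding is_arg_min_def using S card lower by (metis not_less)
  ultimately show ?thesis ..
qed

end
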